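(* For each positive integer $m$, let $D_{\mathbb{R},m}$ be the optimal constant in the real polynomial Bohnenblust--Hille inequality, i.e. the infimum of all $D>0$ such that $|P|_{\frac{2m}{m+1}}\le D\,\|P\|$ for every $n\in\mathbb{N}$ and every $m$-homogeneous polynomial $P$ on $\mathbb{R}^n$ with real coefficients, where $\|P\|=\max_{x\in[-1,1]^n}|P(x)|$. Then $$\limsup_{m\to\infty} D_{\mathbb{R},m}^{1/m}=2.$$
   Context: An $m$-homogeneous polynomial on $\mathbb{R}^n$ is written $P(x)=\sum_{|\alpha|=m}a_\alpha x^\alpha$, where $\alpha=(\alpha_1,\dots,\alpha_n)\in(\mathbb{N}\cup\{0\})^n$, $|\alpha|=\alpha_1+\cdots+\alpha_n$, $x^\alpha=x_1^{\alpha_1}\cdots x_n^{\alpha_n}$, and $a_\alpha\in\mathbb{R}$. For $p\ge 1$, $|P|_p=\left(\sum_{|\alpha|=m}|a_\alpha|^p\right)^{1/p}$ is the $\ell_p$ norm of the coefficients. The polynomial norm is $\|P\|=\sup\{|P(x)|: x\in\mathbb{R}^n,\ \max_i|x_i|\le 1\}$, i.e. the norm of $P$ as a polynomial on the real space $\ell_\infty^n$. By the Bohnenblust--Hille theorem, $D_{\mathbb{R},m}<\infty$ for every $m$. *)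

theory Defs
  imports Complex_Main "HOL-Library.Extended_Real"
begin

text \<open>
  Points of \<open>\<real>\<^sup>n\<close> and multi-indices are functions on \<open>nat\<close> of which only the values
  at \<open>0, \<dots>, n - 1\<close> matter, because the constant below quantifies over \<open>n\<close>. Multi-indices
  are required to vanish from \<open>n\<close> on, so that each one is represented by exactly one function.
\<close>

definition multi_indices :: "nat \<Rightarrow> nat \<Rightarrow> (nat \<Rightarrow> nat) set" where
  "multi_indices n m = {\<alpha>. (\<forall>i\<ge>n. \<alpha> i = 0) \<and> (\<Sum>i<n. \<alpha> i) = m}"

lemma finite_multi_indices: "finite (multi_indices n m)"
proof (rule finite_subset)
  show "multi_indices n m \<subseteq> {\<alpha>. \<forall>i. (i \<in> {..<n} \<longrightarrow> \<alpha> i \<in> {..m}) \<and> (i \<notin> {..<n} \<longrightarrow> \<alpha> i = 0)}"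
    by (auto simp: multi_indices_def intro: member_le_sum)
  show "finite {\<alpha>::nat \<Rightarrow> nat. \<forall>i. (i \<in> {..<n} \<longrightarrow> \<alpha> i \<in> {..m}) \<and> (i \<notin> {..<n} \<longrightarrow> \<alpha> i = 0)}"
    by (rule finite_set_of_finite_funs) auto
qed

text \<open>
  An \<open>m\<close>-homogeneous polynomial on \<open>\<real>\<^sup>n\<close> is given by its coefficient family \<open>a\<close>;
  only the values of \<open>a\<close> on \<^term>\<open>multi_indices n m\<close> are ever used.
\<close>

definition hpoly_eval ::
  "nat \<Rightarrow> nat \<Rightarrow> ((nat \<Rightarrow> nat) \<Rightarrow> real) \<Rightarrow> (nat \<Rightarrow> real) \<Rightarrow> real" where
  "hpoly_eval n m a x = (\<Sum>\<alpha>\<in>multi_indices n m. a \<alpha> * (\<Prod>i<n. x i ^ \<alpha> i))"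

definition coeff_norm :: "nat \<Rightarrow> nat \<Rightarrow> real \<Rightarrow> ((nat \<Rightarrow> nat) \<Rightarrow> real) \<Rightarrow> real" where
  "coeff_norm n m p a = (\<Sum>\<alpha>\<in>multi_indices n m. \<bar>a \<alpha>\<bar> powr p) powr (1 / p)"

definition hpoly_norm :: "nat \<Rightarrow> nat \<Rightarrow> ((nat \<Rightarrow> nat) \<Rightarrow> real) \<Rightarrow> real" where
  "hpoly_norm n m a = (SUP x\<in>{x. \<forall>i<n. \<bar>x i\<bar> \<le> 1}. \<bar>hpoly_eval n m a x\<bar>)"

text \<open>
  The infimum is taken in \<open>\<real>\<close>: the set is bounded below by \<open>0\<close>, and for \<open>m \<ge> 1\<close> it is
  nonempty by the Bohnenblust--Hille theorem.
\<close>

definition BH_const :: "nat \<Rightarrow> real" where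
  "BH_const m = Inf {D. D > 0 \<and>
     (\<forall>n\<ge>1. \<forall>a. coeff_norm n m (2 * real m / (real m + 1)) a \<le> D * hpoly_norm n m a)}"

end

theory Submission
  imports Defs "HOL-Library.FuncSet" "HOL-Library.Multiset" "HOL-Real_Asymp.Real_Asymp"
begin

text \<open>
  Upper bound. A real form of degree \<open>m\<close> and supremum \<open>1\<close> on the cube is bounded by \<open>2 ^ m\<close> on the complex
  polydisc, so it suffices that the complex polynomial Bohnenblust--Hille constants are subexponential.
  Following Bayart, Pellegrino and Seoane-Sepulveda, split the \<open>m\<close> letters of a monomial into blocks of length
  \<open>j \<in> [k, 2k)\<close> and interpolate between the mixed norms \<open>\<ell>\<^sub>s (\<ell>\<^sub>2)\<close>, \<open>s = 2 j / (j + 1)\<close>, one for each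
  block. The inner \<open>\<ell>\<^sub>2\<close> norm is at most the \<open>L\<^sup>2\<close> norm of a Taylor coefficient of \<open>w \<mapsto> P (z + w)\<close>, which
  is compared with its \<open>L\<^sup>s\<close> norm at the cost of a factor \<open>2 ^ (m / j)\<close>; the outer sum is then the
  degree \<open>j\<close> inequality applied to the degree \<open>j\<close> part in \<open>w\<close>, whose supremum is at most
  \<open>e m ^ j\<close> by Cauchy's estimate. Taking \<open>k = 1\<close> gives finite constants in all degrees, and then large
  \<open>k\<close> gives growth \<open>2 ^ (m / k)\<close> up to polynomial factors. All torus averages are over grids of roots of unity.

  Lower bound. Iterating \<open>Q x\<^sup>2 - Q y\<^sup>2\<close> in disjoint variables gives a form of degree \<open>2 ^ k\<close> in \<open>2 ^ k\<close>
  variables that is bounded by \<open>1\<close> on the real cube and attains \<open>2 ^ (2 ^ k - 1)\<close> on the polydisc. Its powers have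
  only polynomially many monomials, so one of their coefficients is almost as large as the complex supremum.
\<close>

section \<open>Interpolation of mixed norms\<close>

lemma power_powr:
  fixes x :: real
  assumes "x \<ge> 0" "n > 0"
  shows "(x ^ n) powr a = x powr (real n * a)"
  using assms by (cases "x = 0") (simp_all add: powr_def ln_realpow mult_ac)

text \<open>Weighted AM-GM: after division by the mean \<open>M\<close>, the bound ln t \<le> t - 1
  has a right side whose weighted sum vanishes.\<close>

lemma young_powr:
  fixes x y a b :: real
  assumes "x \<ge> 0" "y \<ge> 0" "a > 0" "b > 0" "a + b = 1"
  shows "x powr a * y powr b \<le> a * x + b * y"
proof (cases "x = 0 \<or> y = 0")
  case True
  then show ?thesis using assms by auto
next
  case False
  define M where "M = a * x + b * y"
  have xy: "x > 0" "y > 0" using False assms by auto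
  have M: "M > 0" unfolding M_def using xy assms by (simp add: add_pos_pos)
  have "a * ln (x / M) + b * ln (y / M) \<le> a * (x / M - 1) + b * (y / M - 1)"
    using assms xy M by (intro add_mono mult_left_mono ln_le_minus_one) auto
  also have "\<dots> = (a * x + b * y) / M - (a + b)" by (simp add: algebra_simps add_divide_distrib)
  also have "\<dots> = 0" using M assms unfolding M_def[symmetric] by simp
  finally have "a * ln x + b * ln y \<le> (a + b) * ln M"
    using xy M by (simp add: ln_div algebra_simps)
  then have "exp (a * ln x + b * ln y) \<le> exp (ln M)" using assms by simp
  then show ?thesis using xy M unfolding M_def by (simp add: powr_def exp_add)
qed

text \<open>Hoelder's inequality with exponents 1/a and 1/b: both sums are normalised to 1 and
  \<open>young_powr\<close> is applied termwise.\<close>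

lemma holder_sum:
  fixes f g :: "'a \<Rightarrow> real"
  assumes "\<And>i. i \<in> I \<Longrightarrow> f i \<ge> 0" "\<And>i. i \<in> I \<Longrightarrow> g i \<ge> 0"
    and ab: "a > 0" "b > 0" "a + b = 1"
  shows "(\<Sum>i\<in>I. f i powr a * g i powr b) \<le> (\<Sum>i\<in>I. f i) powr a * (\<Sum>i\<in>I. g i) powr b"
proof (cases "finite I \<and> sum f I \<noteq> 0 \<and> sum g I \<noteq> 0")
  case True
  define F where "F = sum f I"
  define G where "G = sum g I"
  have FG: "F > 0" "G > 0"
    using True assms by (auto simp: F_def G_def order_less_le intro: sum_nonneg)
  have "(\<Sum>i\<in>I. f i powr a * g i powr b)
      = F powr a * G powr b * (\<Sum>i\<in>I. (f i / F) powr a * (g i / G) powr b)"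
    unfolding sum_distrib_left
  proof (intro sum.cong refl)
    fix i assume "i \<in> I"
    show "f i powr a * g i powr b = F powr a * G powr b * ((f i / F) powr a * (g i / G) powr b)"
      using FG powr_mult[of F "f i / F" a] powr_mult[of G "g i / G" b] by (simp add: mult_ac)
  qed
  also have "\<dots> \<le> F powr a * G powr b * (\<Sum>i\<in>I. a * (f i / F) + b * (g i / G))"
    using assms FG by (intro mult_left_mono sum_mono young_powr) auto
  also have "(\<Sum>i\<in>I. a * (f i / F) + b * (g i / G)) = a * (F / F) + b * (G / G)"
    by (simp only: sum.distrib F_def G_def sum_distrib_left sum_divide_distrib)
  also have "\<dots> = 1" using FG ab by simp
  finally show ?thesis by (simp add: F_def G_def)
next
  \<comment> \<open>An infinite \<open>I\<close> makes every sum 0 by convention; otherwise a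
    vanishing sum forces its terms, and so all products, to be 0.\<close>
  case False
  have "(\<Sum>i\<in>I. f i powr a * g i powr b) = 0"
  proof (cases "finite I")
    case True
    then have "(\<forall>i\<in>I. f i = 0) \<or> (\<forall>i\<in>I. g i = 0)"
      using False assms(1,2) by (simp add: sum_nonneg_eq_0_iff)
    then show ?thesis using ab by (intro sum.neutral) auto
  qed auto
  then show ?thesis by simp
qed

text \<open>A reverse Hoelder inequality: the second moment interpolates between those of orders s
  and 4, and the fourth is controlled by the square of the second, so the inequality can be solved
  for the moment of order s.\<close>

lemma moment_interpolation:
  fixes g :: "'a \<Rightarrow> real"
  assumes fin: "finite I" "I \<noteq> {}" and g: "\<And>i. i \<in> I \<Longrightarrow> g i \<ge> 0"
    and s: "0 < s" "s < 2" and Q: "Q > 0"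
    and e: "(\<Sum>i\<in>I. g i ^ 2) = real (card I) * e"
    and four: "(\<Sum>i\<in>I. g i ^ 4) \<le> real (card I) * (Q * e ^ 2)"
  shows "real (card I) * e powr (s / 2) \<le> Q powr ((2 - s) / 2) * (\<Sum>i\<in>I. g i powr s)"
proof (cases "e = 0")
  case True
  then show ?thesis using s g by (auto intro!: mult_nonneg_nonneg sum_nonneg)
next
  case False
  define W where "W = real (card I)"
  have W: "W > 0" using fin by (simp add: W_def card_gt_0_iff)
  have "W * e \<ge> 0" unfolding W_def e[symmetric] by (intro sum_nonneg) auto
  then have e0: "e > 0" using W False by (simp add: zero_le_mult_iff)
  \<comment> \<open>These weights solve a + b = 1 and s a + 4 b = 2.\<close>
  define a where "a = 2 / (4 - s)"
  define b where "b = (2 - s) / (4 - s)"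
  have ab: "a > 0" "b > 0" "a + b = 1"
    using s by (auto simp: a_def b_def simp flip: add_divide_distrib)
  have "s * a + 4 * b = (s * 2 + 4 * (2 - s)) / (4 - s)"
    by (simp add: a_def b_def flip: add_divide_distrib)
  also have "\<dots> = 2" using s by (simp add: divide_eq_eq)
  finally have ab4: "s * a + 4 * b = 2" .
  define S where "S = (\<Sum>i\<in>I. g i powr s)"
  have S0: "S \<ge> 0" unfolding S_def by (intro sum_nonneg) auto
  have pt: "g i ^ 2 = (g i powr s) powr a * (g i ^ 4) powr b" if "i \<in> I" for i
  proof (cases "g i = 0")
    case False
    then have "g i > 0" using g[OF that] by simp
    then show ?thesis using ab4
      by (simp add: powr_powr power_powr flip: powr_add)
  qed (use ab s in auto)
  have "W * e = (\<Sum>i\<in>I. (g i powr s) powr a * (g i ^ 4) powr b)"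
    unfolding W_def e[symmetric] using pt by (intro sum.cong) auto
  also have "\<dots> \<le> S powr a * (\<Sum>i\<in>I. g i ^ 4) powr b"
    unfolding S_def using ab by (intro holder_sum) auto
  also have "\<dots> \<le> S powr a * (W * (Q * e ^ 2)) powr b"
    using four ab by (intro mult_left_mono powr_mono2) (auto simp: W_def sum_nonneg)
  finally have *: "W * e \<le> S powr a * (W * (Q * e ^ 2)) powr b" .
  then have "S \<noteq> 0" using W e0 ab by (auto simp: mult_le_0_iff)
  then have S: "S > 0" using S0 by simp
  have "ln (W * e) \<le> ln (S powr a * (W * (Q * e ^ 2)) powr b)"
    using * W e0 by (intro ln_mono) auto
  then have "ln W + ln e \<le> a * ln S + b * (ln W + ln Q + 2 * ln e)"
    using S W e0 Q by (simp add: ln_mult  ln_realpow add.assoc)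
  then have "(4 - s) * (ln W + ln e) \<le> (4 - s) * (a * ln S + b * (ln W + ln Q + 2 * ln e))"
    using s by (intro mult_left_mono) auto
  also have "\<dots> = ((4 - s) * a) * ln S + ((4 - s) * b) * (ln W + ln Q + 2 * ln e)"
    by (simp only: distrib_left mult.assoc)
  also have "(4 - s) * a = 2" unfolding a_def times_divide_eq_right by (rule nonzero_mult_div_cancel_left) (use s in simp)
  also have "(4 - s) * b = 2 - s" unfolding b_def times_divide_eq_right by (rule nonzero_mult_div_cancel_left) (use s in simp)
  finally have "ln W + s / 2 * ln e \<le> (2 - s) / 2 * ln Q + ln S"
    by (simp add: field_simps)
  then have "ln (W * e powr (s / 2)) \<le> ln (Q powr ((2 - s) / 2) * S)"
    using S W e0 Q by (simp add: ln_mult)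
  then show ?thesis using S W e0 Q by (simp add: W_def S_def)
qed

text \<open>Minkowski's inequality in \<open>\<ell>\<^sub>q\<close> with \<open>q = 2 / t\<close>, by pairing with the extremal vector of the dual norm.\<close>

lemma mixed_norm_swap:
  fixes f :: "'a \<Rightarrow> 'b \<Rightarrow> real"
  assumes f: "\<And>x y. f x y \<ge> 0"
    and t: "0 < t" "t < 2" and A: "A \<ge> 0"
    and H: "(\<Sum>y\<in>Y. (\<Sum>x\<in>X. (f x y)\<^sup>2) powr (t / 2)) \<le> A powr t"
  shows "(\<Sum>x\<in>X. (\<Sum>y\<in>Y. f x y powr t) powr (2 / t)) \<le> A\<^sup>2"
proof -
  define F where "F x = (\<Sum>y\<in>Y. f x y powr t)" for x
  define T where "T = (\<Sum>x\<in>X. F x powr (2 / t))"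
  have F0: "F x \<ge> 0" for x unfolding F_def by (intro sum_nonneg) auto
  have T0: "T \<ge> 0" unfolding T_def by (intro sum_nonneg) auto
  define a where "a = 1 - t / 2"
  have a: "a > 0" "t / 2 > 0" "a + t / 2 = 1" "2 / t * a + 1 = 2 / t" using t by (auto simp: a_def field_simps)
  \<comment> \<open>One factor \<open>F x\<close> is split off and expanded as a sum over y; Hoelder
    in x then gives T \<le> T^(1 - t/2) A^t, which is solved for T.\<close>
  have "T = (\<Sum>x\<in>X. (F x powr (2 / t)) powr a * F x)"
    unfolding T_def
  proof (intro sum.cong refl)
    fix x
    have "(F x powr (2 / t)) powr a * F x = F x powr (1 + 2 / t * a)"
      by (simp only: powr_powr mult.commute[of _ "F x"] powr_mult_base[OF F0])
    then show "F x powr (2 / t) = (F x powr (2 / t)) powr a * F x"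
      using a(4) by (simp only: add.commute)
  qed
  also have "\<dots> = (\<Sum>x\<in>X. \<Sum>y\<in>Y. (F x powr (2 / t)) powr a * ((f x y)\<^sup>2) powr (t / 2))"
  proof -
    have "f x y powr t = ((f x y)\<^sup>2) powr (t / 2)" for x y
      using f[of x y] by (simp add: power_powr)
    then show ?thesis unfolding F_def by (simp add: sum_distrib_left)
  qed
  also have "\<dots> = (\<Sum>y\<in>Y. \<Sum>x\<in>X. (F x powr (2 / t)) powr a * ((f x y)\<^sup>2) powr (t / 2))"
    by (rule sum.swap)
  also have "\<dots> \<le> (\<Sum>y\<in>Y. T powr a * (\<Sum>x\<in>X. (f x y)\<^sup>2) powr (t / 2))"
    unfolding T_def using a by (intro sum_mono holder_sum) auto
  also have "\<dots> \<le> T powr a * A powr t"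
    using H by (simp add: mult_left_mono flip: sum_distrib_left)
  finally have *: "T \<le> T powr a * A powr t" .
  show ?thesis
  proof (cases "T = 0 \<or> A = 0")
    case True
    then have "T \<le> 0" using * t by auto
    then show ?thesis unfolding T_def F_def by (simp add: order_trans)
  next
    case False
    then have TA: "T > 0" "A > 0" using T0 A by auto
    then have "ln T \<le> ln (T powr a * A powr t)" using * by (intro ln_mono) auto
    then have "ln T \<le> a * ln T + t * ln A" using TA by (simp add: ln_mult)
    then have "t / 2 * ln T \<le> t / 2 * (2 * ln A)" by (simp add: a_def algebra_simps)
    then have "ln T \<le> 2 * ln A" using t by (simp only: mult_le_cancel_left_pos a)
    then have "ln T \<le> ln (A\<^sup>2)" using TA by (simp add: ln_realpow)
    then have "T \<le> A\<^sup>2" using TA by (simp only: ln_le_cancel_iff zero_less_power)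
    then show ?thesis unfolding T_def F_def .
  qed
qed

text \<open>Hoelder is used twice: over y between the exponents 2 and t, then over x between s and
  2. \<open>mixed_norm_swap\<close> first brings the second hypothesis to an outer sum over
  x.\<close>

lemma mixed_norm_interpolation:
  fixes f :: "'a \<Rightarrow> 'b \<Rightarrow> real"
  assumes f: "\<And>x y. f x y \<ge> 0" and A: "A \<ge> 0"
    and s: "0 < s" and t: "0 < t" "t < 2" and r: "r > 0"
    and \<theta>: "0 < \<theta>" "\<theta> < 1"
    and r1: "1 / r = \<theta> / s + (1 - \<theta>) / 2" and r2: "1 / r = \<theta> / 2 + (1 - \<theta>) / t"
    and H1: "(\<Sum>x\<in>X. (\<Sum>y\<in>Y. (f x y)\<^sup>2) powr (s / 2)) \<le> A powr s"
    and H2: "(\<Sum>y\<in>Y. (\<Sum>x\<in>X. (f x y)\<^sup>2) powr (t / 2)) \<le> A powr t"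
  shows "(\<Sum>x\<in>X. \<Sum>y\<in>Y. f x y powr r) \<le> A powr r"
proof -
  \<comment> \<open>Hoelder weights: \<open>a\<close>, \<open>b\<close> for the inner exponent in y,
    by \<open>r2\<close>, and \<open>a'\<close>, \<open>b'\<close> for the outer exponent in x, by
    \<open>r1\<close>.\<close>
  define a b where "a = r * \<theta> / 2" and "b = r * (1 - \<theta>) / t"
  define a' b' where "a' = r * \<theta> / s" and "b' = r * (1 - \<theta>) / 2"
  have "r * (1 / r) = r * (\<theta> / s + (1 - \<theta>) / 2)" using r1 by simp
  then have 1: "a' + b' = 1" using r by (simp add: a'_def b'_def distrib_left)
  have "r * (1 / r) = r * (\<theta> / 2 + (1 - \<theta>) / t)" using r2 by simp
  then have 2: "a + b = 1" using r by (simp add: a_def b_def distrib_left)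
  have pos: "a > 0" "b > 0" "a' > 0" "b' > 0"
    using r \<theta> s t by (auto simp: a_def b_def a'_def b'_def)
  have 3: "2 * a + t * b = r" "s / 2 * a' = a" "2 / t * b' = b" "s * a' + 2 * b' = r"
    using s t by (auto simp: a_def b_def a'_def b'_def) (simp_all add: algebra_simps)
  define F where "F x = (\<Sum>y\<in>Y. (f x y)\<^sup>2)" for x
  define G where "G x = (\<Sum>y\<in>Y. f x y powr t)" for x
  have "(\<Sum>x\<in>X. \<Sum>y\<in>Y. f x y powr r) \<le> (\<Sum>x\<in>X. F x powr a * G x powr b)"
  proof (intro sum_mono)
    fix x
    have "f x y powr r = ((f x y)\<^sup>2) powr a * (f x y powr t) powr b" for y
      using f[of x y] 3(1) by (simp add: power_powr powr_powr flip: powr_add)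
    then show "(\<Sum>y\<in>Y. f x y powr r) \<le> F x powr a * G x powr b"
      unfolding F_def G_def using pos 2 by (simp only:) (intro holder_sum, auto)
  qed
  also have "\<dots> = (\<Sum>x\<in>X. (F x powr (s / 2)) powr a' * (G x powr (2 / t)) powr b')"
    by (simp only: powr_powr 3)
  also have "\<dots> \<le> (\<Sum>x\<in>X. F x powr (s / 2)) powr a' * (\<Sum>x\<in>X. G x powr (2 / t)) powr b'"
    using pos 1 by (intro holder_sum) auto
  also have "\<dots> \<le> (A powr s) powr a' * (A\<^sup>2) powr b'"
  proof (intro mult_mono powr_mono2)
    show "(\<Sum>x\<in>X. F x powr (s / 2)) \<le> A powr s" using H1 unfolding F_def .
    show "(\<Sum>x\<in>X. G x powr (2 / t)) \<le> A\<^sup>2"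
      unfolding G_def using assms by (intro mixed_norm_swap) auto
  qed (use pos in \<open>auto intro!: sum_nonneg\<close>)
  also have "\<dots> = A powr r"
    using A 3(4) by (simp add: power_powr powr_powr flip: powr_add)
  finally show ?thesis .
qed

section \<open>Blei's inequality for arrays indexed by words\<close>

definition rho :: "nat \<Rightarrow> real" where "rho k = 2 * real k / (real k + 1)"

lemma inverse_rho: "k \<ge> 1 \<Longrightarrow> 1 / rho k = 1 / 2 + 1 / (2 * real k)"
  by (simp add: rho_def field_simps)

lemma rho_bounds: "k \<ge> 1 \<Longrightarrow> 1 \<le> rho k" "rho k < 2" "k \<ge> 1 \<Longrightarrow> rho k > 0"
  by (auto simp: rho_def field_simps)

text \<open>Index tuples of a k-linear form in n variables; with lists, splitting into blocks is
  concatenation.\<close>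

definition words :: "nat \<Rightarrow> nat \<Rightarrow> nat list set" where
  "words n k = {xs. set xs \<subseteq> {..<n} \<and> length xs = k}"

lemma finite_words [simp]: "finite (words n k)"
  unfolding words_def by (rule finite_lists_length_eq) simp

lemma sum_words_append:
  "(\<Sum>xs\<in>words n (k + l). f xs) = (\<Sum>x\<in>words n k. \<Sum>y\<in>words n l. f (x @ y))"
proof -
  have "(\<Sum>xs\<in>words n (k + l). f xs) = (\<Sum>(x, y)\<in>words n k \<times> words n l. f (x @ y))"
    by (rule sum.reindex_bij_witness[where i = "\<lambda>(x, y). x @ y" and j = "\<lambda>xs. (take k xs, drop k xs)"])
       (auto simp: words_def dest: in_set_takeD in_set_dropD)
  then show ?thesis by (simp add: sum.cartesian_product)
qed

lemma words_0 [simp]: "words n 0 = {[]}" by (auto simp: words_def)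

text \<open>
  The first block of length \<open>k\<close> is split off; the \<open>\<ell>\<^sub>2\<close> norm of \<open>f\<close> over that block is a function
  of the remaining letters with the same mixed norm bounds, so that two-factor interpolation applies.
\<close>

lemma blei_words:
  fixes f :: "nat list \<Rightarrow> real"
  assumes k: "k \<ge> 1" and "m \<ge> k" and A: "A \<ge> 0" and "\<And>xs. f xs \<ge> 0"
    and "\<And>p j q. k \<le> j \<Longrightarrow> j < 2 * k \<Longrightarrow> p + j + q = m \<Longrightarrow>
      (\<Sum>x\<in>words n j. (\<Sum>u\<in>words n p. \<Sum>v\<in>words n q. (f (u @ x @ v))\<^sup>2) powr (rho j / 2)) \<le> A powr rho j"
  shows "(\<Sum>xs\<in>words n m. f xs powr rho m) \<le> A powr rho m"
  using assms(2,4,5)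
proof (induction m arbitrary: f rule: less_induct)
  case (less m)
  show ?case
  proof (cases "m < 2 * k")
    case True
    have "(f xs)\<^sup>2 powr (rho m / 2) = f xs powr rho m" for xs
      using less.prems(2)[of xs] by (simp add: power_powr)
    \<comment> \<open>The whole word is a single block, and the inner sums over empty words have one
      term.\<close>
    then show ?thesis using less.prems(3)[of m 0 0] less.prems(1) True by simp
  next
    case False
    define l where "l = m - k"
    have l: "m = k + l" "l \<ge> k" "l < m" using False k by (auto simp: l_def)
    define g where "g y = sqrt (\<Sum>x\<in>words n k. (f (x @ y))\<^sup>2)" for y
    have g2: "(g y)\<^sup>2 = (\<Sum>x\<in>words n k. (f (x @ y))\<^sup>2)" for y
      unfolding g_def by (simp add: sum_nonneg)
    have "(\<Sum>y\<in>words n l. g y powr rho l) \<le> A powr rho l"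
    proof (rule less.IH)
      fix p j q assume *: "k \<le> j" "j < 2 * k" "p + j + q = l"
      \<comment> \<open>The letters summed out in \<open>g\<close> join the prefix \<open>u\<close>:
        a block of \<open>g\<close> after p letters is a block of \<open>f\<close> after k + p
        letters.\<close>
      have "(\<Sum>u\<in>words n p. \<Sum>v\<in>words n q. (g (u @ x @ v))\<^sup>2)
          = (\<Sum>u\<in>words n (k + p). \<Sum>v\<in>words n q. (f (u @ x @ v))\<^sup>2)" for x
        unfolding g2 sum_words_append append_assoc
        by (simp only: sum.swap[of _ "words n k" "words n q"]) (rule sum.swap)
      then show "(\<Sum>x\<in>words n j. (\<Sum>u\<in>words n p. \<Sum>v\<in>words n q. (g (u @ x @ v))\<^sup>2) powr (rho j / 2)) \<le> A powr rho j"
        using less.prems(3)[of j "k + p" q] * l by simp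
    qed (use l in \<open>auto simp: g_def sum_nonneg\<close>)
    moreover have "g y powr rho l = (\<Sum>x\<in>words n k. (f (x @ y))\<^sup>2) powr (rho l / 2)" for y
      unfolding g2[symmetric] by (subst power_powr) (auto simp: g_def sum_nonneg)
    ultimately have H2: "(\<Sum>y\<in>words n l. (\<Sum>x\<in>words n k. (f (x @ y))\<^sup>2) powr (rho l / 2)) \<le> A powr rho l"
      by simp
    have H1: "(\<Sum>x\<in>words n k. (\<Sum>y\<in>words n l. (f (x @ y))\<^sup>2) powr (rho k / 2)) \<le> A powr rho k"
      using less.prems(3)[of k 0 l] k l by simp
    \<comment> \<open>Since 1 / rho k exceeds 1/2 by 1 / (2 k), the weights k / m and l / m turn the
      excess of either block into 1 / (2 m), the excess for \<open>rho m\<close>.\<close>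
    define \<theta> where "\<theta> = real k / real m"
    have "(\<Sum>x\<in>words n k. \<Sum>y\<in>words n l. f (x @ y) powr rho m) \<le> A powr rho m"
    proof (rule mixed_norm_interpolation[where \<theta> = \<theta>, OF _ A _ _ _ _ _ _ _ _ H1 H2])
      have "\<theta> / rho k = \<theta> * (1 / rho k)" "(1 - \<theta>) / rho l = (1 - \<theta>) * (1 / rho l)" by simp_all
      moreover have "\<theta> * (1 / (2 * real k)) = 1 / (2 * real m)" using k l by (simp add: \<theta>_def)
      moreover have "1 - \<theta> = real l / real m" using k l by (simp add: \<theta>_def field_simps)
      then have "(1 - \<theta>) * (1 / (2 * real l)) = 1 / (2 * real m)" using k l by simp
      ultimately have "\<theta> / rho k = \<theta> / 2 + 1 / (2 * real m)"
          "(1 - \<theta>) / rho l = (1 - \<theta>) / 2 + 1 / (2 * real m)"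
        using k l by (simp_all only: inverse_rho distrib_left)
      moreover have "1 / rho m = 1 / 2 + 1 / (2 * real m)" using k l by (intro inverse_rho) simp
      ultimately show "1 / rho m = \<theta> / rho k + (1 - \<theta>) / 2" "1 / rho m = \<theta> / 2 + (1 - \<theta>) / rho l"
        by (simp_all only: diff_divide_distrib)
    qed (use k l in \<open>simp_all add: \<theta>_def less.prems(2) rho_bounds\<close>)
    then show ?thesis by (simp add: l(1) sum_words_append)
  qed
qed

section \<open>Polynomials on grids of roots of unity\<close>

definition ceval :: "nat \<Rightarrow> nat \<Rightarrow> ((nat \<Rightarrow> nat) \<Rightarrow> complex) \<Rightarrow> (nat \<Rightarrow> complex) \<Rightarrow> complex" where
  "ceval n m c z = (\<Sum>\<alpha>\<in>multi_indices n m. c \<alpha> * (\<Prod>i<n. z i ^ \<alpha> i))"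

lemma of_real_norm_square: "(complex_of_real (cmod z))\<^sup>2 = z * cnj z"
  by (simp flip: complex_norm_square)

section \<open>Discrete Fourier orthogonality\<close>

definition unity :: "nat \<Rightarrow> complex" where
  "unity N = cis (2 * pi / real N)"

lemma norm_unity [simp]: "cmod (unity N) = 1" by (simp add: unity_def)

text \<open>The summands form a geometric progression whose ratio \<open>x\<close> is an N-th root
  of unity; distinct exponents below N differ by less than N, so then \<open>x\<close> is not
  1.\<close>

lemma unity_orthogonal:
  assumes "a < N" "b < N"
  shows "(\<Sum>t<N. (unity N ^ t) ^ a * cnj ((unity N ^ t) ^ b)) = (if a = b then of_nat N else 0)"
proof -
  have N: "N > 0" using assms by simp
  define x where "x = unity N ^ a * cnj (unity N ^ b)"
  have "(unity N ^ t) ^ a * cnj ((unity N ^ t) ^ b) = x ^ t" for t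
    by (simp add: x_def power_mult_distrib mult.commute flip: power_mult)
  then have *: "(\<Sum>t<N. (unity N ^ t) ^ a * cnj ((unity N ^ t) ^ b)) = (\<Sum>t<N. x ^ t)" by simp
  have x: "x = cis (2 * pi * ((real a - real b) / real N))"
    by (simp add: x_def unity_def DeMoivre cis_cnj cis_mult algebra_simps diff_divide_distrib)
  show ?thesis
  proof (cases "a = b")
    case True
    then have "x = 1" by (simp add: x)
    then show ?thesis unfolding * using True by simp
  next
    case False
    have "x \<noteq> 1"
    proof
      assume "x = 1"
      then have "cos (2 * pi * ((real a - real b) / real N)) = 1"
        unfolding x by (metis cis.simps(1) one_complex.simps(1))
      then obtain k :: int where "2 * pi * ((real a - real b) / real N) = of_int k * 2 * pi"
        using cos_one_2pi_int by blast
      then have "(2 * pi) * ((real a - real b) / real N) = (2 * pi) * of_int k" by (simp only: mult_ac)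
      then have "(real a - real b) / real N = of_int k" by (subst (asm) mult_left_cancel) auto
      then have "real a - real b = of_int k * real N" using N by (simp add: field_simps)
      then have "of_int (int a - int b) = (of_int (k * int N) :: real)" by simp
      then have eq: "int a - int b = k * int N" using of_int_eq_iff by blast
      then have "int N dvd int a - int b" by simp
      moreover have "\<bar>int a - int b\<bar> < int N" using assms by linarith
      ultimately have "int a - int b = 0" using zdvd_not_zless[of "\<bar>int a - int b\<bar>" "int N"] by auto
      then show False using False by simp
    qed
    moreover have "x ^ N = 1"
      using N by (simp add: x DeMoivre cis_multiple_2pi[of "real a - real b"])
    ultimately show ?thesis unfolding * using False by (simp add: geometric_sum)
  qed
qed

text \<open>A finite stand-in for the torus: for exponents below N, a monomial times a conjugate
  monomial has the same average on both.\<close>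

definition grid :: "nat \<Rightarrow> nat \<Rightarrow> (nat \<Rightarrow> nat) set" where
  "grid n N = PiE {..<n} (\<lambda>_. {..<N})"

definition root_point :: "nat \<Rightarrow> (nat \<Rightarrow> nat) \<Rightarrow> nat \<Rightarrow> complex" where
  "root_point N \<theta> i = unity N ^ \<theta> i"

lemma norm_root_point [simp]: "cmod (root_point N \<theta> i) = 1"
  by (simp add: root_point_def norm_power)

lemma finite_grid [simp]: "finite (grid n N)" by (simp add: grid_def finite_PiE)

lemma card_grid [simp]: "card (grid n N) = N ^ n" by (simp add: grid_def card_PiE)

lemma grid_nonempty: "N > 0 \<Longrightarrow> grid n N \<noteq> {}"
  by (auto simp: grid_def PiE_eq_empty_iff)

lemma grid_orthogonal:
  assumes "\<And>v. v < n \<Longrightarrow> a v < N" "\<And>v. v < n \<Longrightarrow> b v < N"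
  shows "(\<Sum>\<theta>\<in>grid n N. (\<Prod>v<n. root_point N \<theta> v ^ a v) * cnj (\<Prod>v<n. root_point N \<theta> v ^ b v))
    = (if \<forall>v<n. a v = b v then of_nat (N ^ n) else 0)"
proof -
  have "(\<Sum>\<theta>\<in>grid n N. (\<Prod>v<n. root_point N \<theta> v ^ a v) * cnj (\<Prod>v<n. root_point N \<theta> v ^ b v))
     = (\<Sum>\<theta>\<in>grid n N. \<Prod>v<n. (unity N ^ \<theta> v) ^ a v * cnj ((unity N ^ \<theta> v) ^ b v))"
    by (simp add: root_point_def prod.distrib)
  also have "\<dots> = (\<Prod>v<n. \<Sum>t<N. (unity N ^ t) ^ a v * cnj ((unity N ^ t) ^ b v))"
    unfolding grid_def by (subst prod_sum_PiE) auto
  also have "\<dots> = (\<Prod>v<n. if a v = b v then of_nat N else 0)"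
    using assms by (intro prod.cong refl unity_orthogonal) auto
  also have "\<dots> = (if \<forall>v<n. a v = b v then of_nat (N ^ n) else 0)"
    by auto
  finally show ?thesis .
qed

text \<open>Several indices may carry the same monomial, as the pairs in the square of a polynomial
  do; only pairs with equal exponents survive averaging.\<close>

lemma grid_square_sum:
  assumes fin: "finite I" and e: "\<And>i v. i \<in> I \<Longrightarrow> v < n \<Longrightarrow> e i v < N"
  shows "complex_of_real (\<Sum>\<theta>\<in>grid n N. (cmod (\<Sum>i\<in>I. c i * (\<Prod>v<n. root_point N \<theta> v ^ e i v)))\<^sup>2)
    = of_nat (N ^ n) * (\<Sum>i\<in>I. \<Sum>j\<in>{j\<in>I. \<forall>v<n. e i v = e j v}. c i * cnj (c j))"
proof -
  define M where "M \<theta> i = (\<Prod>v<n. root_point N \<theta> v ^ e i v)" for \<theta> i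
  have "complex_of_real (\<Sum>\<theta>\<in>grid n N. (cmod (\<Sum>i\<in>I. c i * M \<theta> i))\<^sup>2)
     = (\<Sum>\<theta>\<in>grid n N. \<Sum>i\<in>I. \<Sum>j\<in>I. (c i * cnj (c j)) * (M \<theta> i * cnj (M \<theta> j)))"
    by (simp add: of_real_norm_square sum_product mult_ac)
  also have "\<dots> = (\<Sum>i\<in>I. \<Sum>\<theta>\<in>grid n N. \<Sum>j\<in>I. (c i * cnj (c j)) * (M \<theta> i * cnj (M \<theta> j)))"
    by (rule sum.swap)
  also have "\<dots> = (\<Sum>i\<in>I. \<Sum>j\<in>I. \<Sum>\<theta>\<in>grid n N. (c i * cnj (c j)) * (M \<theta> i * cnj (M \<theta> j)))"
    by (intro sum.cong refl) (rule sum.swap)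
  also have "\<dots> = (\<Sum>i\<in>I. \<Sum>j\<in>I. (c i * cnj (c j)) * (if \<forall>v<n. e i v = e j v then of_nat (N ^ n) else 0))"
    unfolding sum_distrib_left[symmetric] M_def using e
    by (intro sum.cong refl arg_cong2[where f = "(*)"] grid_orthogonal) auto
  also have "\<dots> = (\<Sum>i\<in>I. \<Sum>j\<in>{j\<in>I. \<forall>v<n. e i v = e j v}. of_nat (N ^ n) * (c i * cnj (c j)))"
  proof (rule sum.cong[OF refl])
    fix i assume "i \<in> I"
    show "(\<Sum>j\<in>I. (c i * cnj (c j)) * (if \<forall>v<n. e i v = e j v then of_nat (N ^ n) else 0))
        = (\<Sum>j\<in>{j\<in>I. \<forall>v<n. e i v = e j v}. of_nat (N ^ n) * (c i * cnj (c j)))"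
      unfolding sum.inter_filter[OF fin] by (intro sum.cong) auto
  qed
  finally show ?thesis unfolding M_def by (simp only: sum_distrib_left)
qed

lemma grid_parseval:
  assumes "finite I" "\<And>i v. i \<in> I \<Longrightarrow> v < n \<Longrightarrow> e i v < N"
    and inj: "\<And>i j. i \<in> I \<Longrightarrow> j \<in> I \<Longrightarrow> (\<forall>v<n. e i v = e j v) \<Longrightarrow> i = j"
  shows "(\<Sum>\<theta>\<in>grid n N. (cmod (\<Sum>i\<in>I. c i * (\<Prod>v<n. root_point N \<theta> v ^ e i v)))\<^sup>2)
    = real (N ^ n) * (\<Sum>i\<in>I. (cmod (c i))\<^sup>2)"
proof -
  have "{j\<in>I. \<forall>v<n. e i v = e j v} = {i}" if "i \<in> I" for i
    using inj that by blast
  then have "complex_of_real (\<Sum>\<theta>\<in>grid n N. (cmod (\<Sum>i\<in>I. c i * (\<Prod>v<n. root_point N \<theta> v ^ e i v)))\<^sup>2)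
    = of_nat (N ^ n) * (\<Sum>i\<in>I. c i * cnj (c i))"
    by (subst grid_square_sum[OF assms(1,2)]) (auto intro: sum.cong)
  also have "\<dots> = complex_of_real (real (N ^ n) * (\<Sum>i\<in>I. (cmod (c i))\<^sup>2))"
    by (simp add: of_real_norm_square)
  finally show ?thesis unfolding of_real_eq_iff .
qed

text \<open>Each surviving product is at most half the sum of the two squares; by symmetry every
  square is counted once per member of its class, hence at most \<open>M\<close> times.\<close>

lemma grid_square_sum_le:
  assumes fin: "finite I" and e: "\<And>i v. i \<in> I \<Longrightarrow> v < n \<Longrightarrow> e i v < N"
    and M: "\<And>i. i \<in> I \<Longrightarrow> real (card {j\<in>I. \<forall>v<n. e i v = e j v}) \<le> M"
  shows "(\<Sum>\<theta>\<in>grid n N. (cmod (\<Sum>i\<in>I. c i * (\<Prod>v<n. root_point N \<theta> v ^ e i v)))\<^sup>2)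
    \<le> real (N ^ n) * (M * (\<Sum>i\<in>I. (cmod (c i))\<^sup>2))" (is "?L \<le> _")
proof -
  define C where "C i = {j\<in>I. \<forall>v<n. e i v = e j v}" for i
  define S where "S = (\<Sum>i\<in>I. \<Sum>j\<in>C i. (cmod (c i))\<^sup>2)"
  have "(\<Sum>i\<in>I. \<Sum>j\<in>C i. (cmod (c j))\<^sup>2) = S"
    unfolding C_def S_def using fin by (subst sum.swap_restrict) (auto intro!: sum.cong)
  then have sym: "(\<Sum>i\<in>I. \<Sum>j\<in>C i. (cmod (c i))\<^sup>2 + (cmod (c j))\<^sup>2) = 2 * S"
    by (simp add: sum.distrib S_def)
  have "?L = cmod (complex_of_real ?L)"
    by (simp only: norm_of_real) (simp add: sum_nonneg)
  also have "\<dots> = real (N ^ n) * cmod (\<Sum>i\<in>I. \<Sum>j\<in>C i. c i * cnj (c j))"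
    by (subst grid_square_sum[OF fin e]) (simp_all add: norm_mult norm_power C_def)
  also have "\<dots> \<le> real (N ^ n) * (\<Sum>i\<in>I. \<Sum>j\<in>C i. ((cmod (c i))\<^sup>2 + (cmod (c j))\<^sup>2) / 2)"
  proof (intro mult_left_mono order_trans[OF norm_sum] sum_mono)
    fix i j
    show "cmod (c i * cnj (c j)) \<le> ((cmod (c i))\<^sup>2 + (cmod (c j))\<^sup>2) / 2"
      using sum_squares_bound[of "cmod (c i)" "cmod (c j)"] by (simp add: norm_mult)
  qed simp
  also have "\<dots> = real (N ^ n) * S"
    by (simp only: sum_divide_distrib[symmetric] sym)
  also have "S = (\<Sum>i\<in>I. real (card (C i)) * (cmod (c i))\<^sup>2)" unfolding S_def by simp
  also have "\<dots> \<le> (\<Sum>i\<in>I. M * (cmod (c i))\<^sup>2)"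
    using M by (intro sum_mono mult_right_mono) (auto simp: C_def)
  finally show ?thesis by (simp add: sum_distrib_left mult_left_mono)
qed

section \<open>Moments, Cauchy estimates and Taylor expansion of forms\<close>

lemma multi_indices_le: "\<alpha> \<in> multi_indices n m \<Longrightarrow> \<alpha> v \<le> m"
  by (cases "v < n") (auto simp: multi_indices_def intro: member_le_sum)

lemma multi_indices_eqI:
  "\<alpha> \<in> multi_indices n m \<Longrightarrow> \<beta> \<in> multi_indices n m' \<Longrightarrow> (\<And>v. v < n \<Longrightarrow> \<alpha> v = \<beta> v) \<Longrightarrow> \<alpha> = \<beta>"
  by (rule ext) (metis (mono_tags, lifting) mem_Collect_eq multi_indices_def not_less)

lemma ceval_grid_L2:
  assumes "d < N"
  shows "(\<Sum>\<theta>\<in>grid n N. (cmod (ceval n d c (root_point N \<theta>)))\<^sup>2)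
    = real (N ^ n) * (\<Sum>\<alpha>\<in>multi_indices n d. (cmod (c \<alpha>))\<^sup>2)"
  unfolding ceval_def using assms
  by (intro grid_parseval finite_multi_indices)
     (auto dest: multi_indices_le[of _ _ d] intro: multi_indices_eqI le_less_trans)

text \<open>
  The square of the polynomial has \<open>\<ell>\<^sub>2\<close> norm controlled by the number of ways of writing a
  multi-index \<open>\<delta>\<close> of degree \<open>2 d\<close> as a sum, which is at most
  \<open>\<Prod>\<^sub>v (\<delta>\<^sub>v + 1) \<le> \<Prod>\<^sub>v 2 ^ \<delta>\<^sub>v = 4 ^ d\<close>.
\<close>

lemma ceval_grid_L4:
  assumes N: "2 * d < N"
  shows "(\<Sum>\<theta>\<in>grid n N. cmod (ceval n d c (root_point N \<theta>)) ^ 4)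
    \<le> real (N ^ n) * (4 ^ d * (\<Sum>\<alpha>\<in>multi_indices n d. (cmod (c \<alpha>))\<^sup>2)\<^sup>2)"
proof -
  define A where "A = multi_indices n d"
  define e :: "(nat \<Rightarrow> nat) \<times> (nat \<Rightarrow> nat) \<Rightarrow> nat \<Rightarrow> nat" where "e = (\<lambda>(\<alpha>, \<beta>) v. \<alpha> v + \<beta> v)"
  define c2 where "c2 = (\<lambda>(\<alpha>, \<beta>). c \<alpha> * c \<beta>)"
  have fA: "finite A" by (simp add: A_def finite_multi_indices)
  have sq: "(ceval n d c z)\<^sup>2 = (\<Sum>p\<in>A \<times> A. c2 p * (\<Prod>v<n. z v ^ e p v))" for z
    by (simp add: ceval_def power2_eq_square sum_product sum.cartesian_product A_def e_def c2_def
        power_add prod.distrib mult_ac split_def)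
  have card: "real (card {q \<in> A \<times> A. \<forall>v<n. e p v = e q v}) \<le> 4 ^ d" if p: "p \<in> A \<times> A" for p
  proof -
    \<comment> \<open>Once the sum of a pair is fixed, the pair is determined by its first
      component, which is bounded coordinatewise by that sum.\<close>
    have "card {q \<in> A \<times> A. \<forall>v<n. e p v = e q v} \<le> card (PiE {..<n} (\<lambda>v. {..e p v}))"
    proof (rule card_inj_on_le[where f = "\<lambda>q. restrict (fst q) {..<n}"])
      show "inj_on (\<lambda>q. restrict (fst q) {..<n}) {q \<in> A \<times> A. \<forall>v<n. e p v = e q v}"
      proof (rule inj_onI, clarify)
        fix a b a' b'
        assume ab: "a \<in> A" "b \<in> A" "a' \<in> A" "b' \<in> A" "\<forall>v<n. e p v = e (a, b) v" "\<forall>v<n. e p v = e (a', b') v"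
          "restrict (fst (a, b)) {..<n} = restrict (fst (a', b')) {..<n}"
        have eq: "a v = a' v" if "v < n" for v
          using fun_cong[OF ab(7), of v] that by simp
        then have "b v = b' v" if "v < n" for v using ab(5,6) that by (simp add: e_def)
        then show "a = a' \<and> b = b'" using eq ab(1-4) unfolding A_def
          by (auto intro: multi_indices_eqI)
      qed
    qed (auto simp: e_def finite_PiE restrict_PiE_iff split: prod.splits if_splits)
    also have "\<dots> = (\<Prod>v<n. Suc (e p v))" by (simp add: card_PiE)
    also have "\<dots> \<le> (\<Prod>v<n. 2 ^ e p v)" by (intro prod_mono) (auto simp: Suc_leI)
    also have "\<dots> = 2 ^ (\<Sum>v<n. e p v)" by (simp add: power_sum)
    also have "(\<Sum>v<n. e p v) = 2 * d"
      using p by (auto simp: e_def A_def multi_indices_def sum.distrib)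
    also have "(2::nat) ^ (2 * d) = 4 ^ d" by (simp add: power_mult)
    finally show ?thesis using of_nat_le_iff[where 'a = real] by fastforce
  qed
  have "(\<Sum>\<theta>\<in>grid n N. cmod (ceval n d c (root_point N \<theta>)) ^ 4)
     = (\<Sum>\<theta>\<in>grid n N. (cmod ((ceval n d c (root_point N \<theta>))\<^sup>2))\<^sup>2)"
    by (simp add: norm_power flip: power_mult)
  also have "\<dots> \<le> real (N ^ n) * (4 ^ d * (\<Sum>p\<in>A \<times> A. (cmod (c2 p))\<^sup>2))"
    unfolding sq
  proof (rule grid_square_sum_le)
    fix p v assume "p \<in> A \<times> A"
    then show "e p v < N"
      using N multi_indices_le[of "fst p" n d v] multi_indices_le[of "snd p" n d v]
      by (auto simp: e_def A_def)
  qed (use fA card in auto)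
  also have "(\<Sum>p\<in>A \<times> A. (cmod (c2 p))\<^sup>2) = (\<Sum>\<alpha>\<in>A. (cmod (c \<alpha>))\<^sup>2)\<^sup>2"
    by (simp add: c2_def split_def norm_mult power_mult_distrib power2_eq_square[of "sum _ _"]
        sum_product sum.cartesian_product)
  finally show ?thesis by (simp add: A_def)
qed

text \<open>Comparison of the mean square of a form with its moment of order s, from the second and
  fourth moments; squaring produces exponents up to 2 d, whence the size of the grid.\<close>

lemma ceval_hypercontractive:
  assumes "0 < s" "s < 2" "2 * d < N"
  shows "real (N ^ n) * (\<Sum>\<alpha>\<in>multi_indices n d. (cmod (c \<alpha>))\<^sup>2) powr (s / 2)
    \<le> (4 ^ d) powr ((2 - s) / 2) * (\<Sum>\<theta>\<in>grid n N. cmod (ceval n d c (root_point N \<theta>)) powr s)"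
  using moment_interpolation[OF finite_grid grid_nonempty, of N n "\<lambda>\<theta>. cmod (ceval n d c (root_point N \<theta>))"
    s "4 ^ d" "\<Sum>\<alpha>\<in>multi_indices n d. (cmod (c \<alpha>))\<^sup>2"] assms
  by (simp add: ceval_grid_L2 ceval_grid_L4 del: of_nat_power)

text \<open>Parseval on one circle: the squares of all \<open>cmod (t i) * r ^ i\<close> add up to a
  mean of squared values, at most B^2, and one term is kept.\<close>

lemma cauchy_estimate:
  fixes t :: "nat \<Rightarrow> complex"
  assumes r: "r > 0" and B: "\<And>l. cmod l = r \<Longrightarrow> cmod (\<Sum>k\<le>m. l ^ k * t k) \<le> B" and k: "k \<le> m"
  shows "cmod (t k) * r ^ k \<le> B"
proof -
  define N where "N = Suc m"
  have B0: "B \<ge> 0" using order_trans[OF norm_ge_zero B[of "of_real r"]] r by simp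
  have *: "(\<Sum>\<theta>\<in>grid 1 N. (cmod (\<Sum>i\<in>{..m}. (t i * of_real r ^ i) * (\<Prod>v<1. root_point N \<theta> v ^ i)))\<^sup>2)
    = real (N ^ 1) * (\<Sum>i\<in>{..m}. (cmod (t i * of_real r ^ i))\<^sup>2)"
    by (rule grid_parseval) (auto simp: N_def)
  have "(\<Sum>\<theta>\<in>grid 1 N. (cmod (\<Sum>i\<in>{..m}. (t i * of_real r ^ i) * (\<Prod>v<1. root_point N \<theta> v ^ i)))\<^sup>2)
    \<le> (\<Sum>\<theta>\<in>grid 1 N. B\<^sup>2)"
  proof (intro sum_mono power_mono)
    fix \<theta>
    have "(\<Sum>i\<in>{..m}. (t i * of_real r ^ i) * (\<Prod>v<1. root_point N \<theta> v ^ i))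
        = (\<Sum>i\<le>m. (of_real r * root_point N \<theta> 0) ^ i * t i)"
      by (intro sum.cong) (auto simp: power_mult_distrib)
    then show "cmod (\<Sum>i\<in>{..m}. (t i * of_real r ^ i) * (\<Prod>v<1. root_point N \<theta> v ^ i)) \<le> B"
      using B r by (simp add: norm_mult)
  qed simp
  then have "real N * (\<Sum>i\<in>{..m}. (cmod (t i * of_real r ^ i))\<^sup>2) \<le> real N * B\<^sup>2"
    unfolding * by simp
  then have "(\<Sum>i\<in>{..m}. (cmod (t i * of_real r ^ i))\<^sup>2) \<le> B\<^sup>2"
    by (simp add: N_def del: of_nat_Suc)
  moreover have "(cmod (t k * of_real r ^ k))\<^sup>2 \<le> (\<Sum>i\<in>{..m}. (cmod (t i * of_real r ^ i))\<^sup>2)"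
    using k by (intro member_le_sum) auto
  ultimately have "(cmod (t k * of_real r ^ k))\<^sup>2 \<le> B\<^sup>2" by linarith
  then have "cmod (t k * of_real r ^ k) \<le> B" using B0 by (rule power2_le_imp_le)
  then show ?thesis using r by (simp add: norm_mult norm_power)
qed

text \<open>The coefficient of \<open>u ^ \<beta> * w ^ \<gamma>\<close> in P (u + w), where P is
  the form with coefficients \<open>c\<close>.\<close>

definition taylor_coeff :: "nat \<Rightarrow> ((nat \<Rightarrow> nat) \<Rightarrow> complex) \<Rightarrow> (nat \<Rightarrow> nat) \<Rightarrow> (nat \<Rightarrow> nat) \<Rightarrow> complex" where
  "taylor_coeff n c \<gamma> \<beta> = of_nat (\<Prod>v<n. (\<beta> v + \<gamma> v) choose \<gamma> v) * c (\<lambda>v. \<beta> v + \<gamma> v)"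

text \<open>The binomial factors are at least 1, so passing to Taylor coefficients only enlarges the
  l2 norms to be estimated.\<close>

lemma norm_taylor_coeff: "cmod (c (\<lambda>v. \<beta> v + \<gamma> v)) \<le> cmod (taylor_coeff n c \<gamma> \<beta>)"
proof -
  have "1 \<le> (\<Prod>v<n. (\<beta> v + \<gamma> v) choose \<gamma> v)"
    by (intro prod_ge_1) (simp add: Suc_leI)
  then have "1 * cmod (c (\<lambda>v. \<beta> v + \<gamma> v)) \<le> real (\<Prod>v<n. (\<beta> v + \<gamma> v) choose \<gamma> v) * cmod (c (\<lambda>v. \<beta> v + \<gamma> v))"
    using of_nat_mono by (intro mult_right_mono) fastforce+
  then show ?thesis unfolding taylor_coeff_def norm_mult norm_of_nat by simp
qed

text \<open>The binomial theorem in each variable gives a sum over \<alpha> and \<gamma> \<le>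
  \<alpha>, which is regrouped by the degree k of \<gamma> with \<beta> = \<alpha> -
  \<gamma>.\<close>

lemma ceval_taylor:
  "ceval n m c (\<lambda>i. u i + l * w i)
    = (\<Sum>k\<le>m. l ^ k * ceval n k (\<lambda>\<gamma>. ceval n (m - k) (taylor_coeff n c \<gamma>) u) w)"
proof -
  define P where "P \<alpha> = PiE {..<n} (\<lambda>v. {..\<alpha> v})" for \<alpha> :: "nat \<Rightarrow> nat"
  define h where "h \<alpha> \<gamma> = c \<alpha> * (\<Prod>v<n. of_nat (\<alpha> v choose \<gamma> v) * (l * w v) ^ \<gamma> v * u v ^ (\<alpha> v - \<gamma> v))" for \<alpha> \<gamma>
  have "ceval n m c (\<lambda>i. u i + l * w i)
     = (\<Sum>\<alpha>\<in>multi_indices n m. c \<alpha> * (\<Prod>v<n. \<Sum>j\<le>\<alpha> v. of_nat (\<alpha> v choose j) * (l * w v) ^ j * u v ^ (\<alpha> v - j)))"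
    unfolding ceval_def by (simp add: add.commute[of "u _"] binomial_ring)
  also have "\<dots> = (\<Sum>\<alpha>\<in>multi_indices n m. \<Sum>\<gamma>\<in>P \<alpha>. h \<alpha> \<gamma>)"
    unfolding P_def h_def sum_distrib_left[symmetric] by (subst prod_sum_PiE) auto
  also have "\<dots> = (\<Sum>(\<alpha>, \<gamma>)\<in>Sigma (multi_indices n m) P. h \<alpha> \<gamma>)"
    by (rule sum.Sigma) (auto simp: finite_multi_indices P_def finite_PiE)
  also have "\<dots> = (\<Sum>(k, \<gamma>, \<beta>)\<in>Sigma {..m} (\<lambda>k. multi_indices n k \<times> multi_indices n (m - k)).
      h (\<lambda>v. \<beta> v + \<gamma> v) \<gamma>)"
  \<comment> \<open>Functions in \<open>PiE\<close> are \<open>undefined\<close> from n on while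
    multi-indices vanish there, hence \<open>restrict\<close> in one direction and the default 0 in
    the other.\<close>
  proof (rule sum.reindex_bij_witness[where
        i = "\<lambda>(k, \<gamma>, \<beta>). (\<lambda>v. \<beta> v + \<gamma> v, restrict \<gamma> {..<n})" and
        j = "\<lambda>(\<alpha>, \<gamma>). (\<Sum>v<n. \<gamma> v, (\<lambda>v. if v < n then \<gamma> v else 0), (\<lambda>v. if v < n then \<alpha> v - \<gamma> v else 0))"],
      goal_cases)
    case (1 p)
    then show ?case
      by (auto simp: P_def PiE_iff multi_indices_def extensional_def fun_eq_iff restrict_def)
  next
    case (2 p)
    obtain \<alpha> \<gamma> where p: "p = (\<alpha>, \<gamma>)" by (cases p)
    then have a: "\<alpha> \<in> multi_indices n m" and g: "\<And>v. v < n \<Longrightarrow> \<gamma> v \<le> \<alpha> v"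
      using 2 by (auto simp: P_def PiE_iff)
    have "(\<Sum>v<n. \<alpha> v - \<gamma> v) + (\<Sum>v<n. \<gamma> v) = (\<Sum>v<n. \<alpha> v)"
      using g by (simp flip: sum.distrib)
    moreover have "(\<Sum>v<n. \<alpha> v) = m" using a by (simp add: multi_indices_def)
    ultimately have "(\<Sum>v<n. \<gamma> v) \<le> m" "(\<Sum>v<n. \<alpha> v - \<gamma> v) = m - (\<Sum>v<n. \<gamma> v)" by linarith+
    then show ?case by (simp add: p multi_indices_def)
  next
    case (3 q)
    then show ?case by (auto simp: multi_indices_def fun_eq_iff)
  next
    case (4 q)
    then show ?case by (auto simp: multi_indices_def P_def PiE_iff sum.distrib)
  next
    case (5 p)
    obtain \<alpha> \<gamma> where p: "p = (\<alpha>, \<gamma>)" by (cases p)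
    then have a: "\<alpha> \<in> multi_indices n m" and g: "\<And>v. v < n \<Longrightarrow> \<gamma> v \<le> \<alpha> v"
      using 5 by (auto simp: P_def PiE_iff)
    have "(\<lambda>v. (if v < n then \<alpha> v - \<gamma> v else 0) + (if v < n then \<gamma> v else 0)) = \<alpha>"
      using a g by (auto simp: fun_eq_iff multi_indices_def)
    then show ?case by (simp only: p prod.case h_def) (auto simp: g intro!: prod.cong)
  qed
  also have "\<dots> = (\<Sum>k\<le>m. \<Sum>(\<gamma>, \<beta>)\<in>multi_indices n k \<times> multi_indices n (m - k). h (\<lambda>v. \<beta> v + \<gamma> v) \<gamma>)"
    by (rule sum.Sigma[symmetric]) (auto simp: finite_multi_indices)
  also have "\<dots> = (\<Sum>k\<le>m. \<Sum>\<gamma>\<in>multi_indices n k. \<Sum>\<beta>\<in>multi_indices n (m - k). h (\<lambda>v. \<beta> v + \<gamma> v) \<gamma>)"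
    by (simp add: sum.cartesian_product)
  also have "\<dots> = (\<Sum>k\<le>m. l ^ k * ceval n k (\<lambda>\<gamma>. ceval n (m - k) (taylor_coeff n c \<gamma>) u) w)"
    unfolding ceval_def sum_distrib_left sum_distrib_right
  proof (intro sum.cong refl)
    fix k \<gamma> \<beta> assume "\<gamma> \<in> multi_indices n k"
    then have "l ^ k = (\<Prod>v<n. l ^ \<gamma> v)" by (simp add: multi_indices_def flip: power_sum)
    then show "h (\<lambda>v. \<beta> v + \<gamma> v) \<gamma>
        = l ^ k * (taylor_coeff n c \<gamma> \<beta> * (\<Prod>i<n. u i ^ \<beta> i) * (\<Prod>i<n. w i ^ \<gamma> i))"
      by (simp add: h_def taylor_coeff_def prod.distrib power_mult_distrib mult_ac)
  qed
  finally show ?thesis .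
qed

section \<open>The complex polynomial inequality\<close>

text \<open>\<open>B\<close> ranges over all upper bounds on the polydisc, so that no supremum has
  to be formed.\<close>

definition complex_BH :: "nat \<Rightarrow> real \<Rightarrow> bool" where
  "complex_BH k K \<longleftrightarrow> (\<forall>n c B. (\<forall>z. (\<forall>i<n. cmod (z i) \<le> 1) \<longrightarrow> cmod (ceval n k c z) \<le> B) \<longrightarrow>
    (\<Sum>\<alpha>\<in>multi_indices n k. cmod (c \<alpha>) powr rho k) \<le> (K * B) powr rho k)"

lemma complex_BH_mono:
  assumes "complex_BH k K" "0 \<le> K" "K \<le> K'" "k \<ge> 1"
  shows "complex_BH k K'"
  unfolding complex_BH_def
proof (intro allI impI)
  fix n c B assume B: "\<forall>z. (\<forall>i<n. cmod (z i) \<le> 1) \<longrightarrow> cmod (ceval n k c z) \<le> B"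
  have "B \<ge> 0" using order_trans[OF norm_ge_zero B[rule_format, of "\<lambda>_. 0"]] by simp
  have "(\<Sum>\<alpha>\<in>multi_indices n k. cmod (c \<alpha>) powr rho k) \<le> (K * B) powr rho k"
    using assms(1) B by (simp add: complex_BH_def)
  also have "\<dots> \<le> (K' * B) powr rho k"
    using assms \<open>B \<ge> 0\<close> rho_bounds(3)[of k] by (intro powr_mono2 mult_right_mono) auto
  finally show "(\<Sum>\<alpha>\<in>multi_indices n k. cmod (c \<alpha>) powr rho k) \<le> (K' * B) powr rho k" .
qed

lemma ceval_scale: "ceval n m c (\<lambda>i. a * z i) = a ^ m * ceval n m c z"
  unfolding ceval_def sum_distrib_left
proof (intro sum.cong refl)
  fix \<alpha> assume "\<alpha> \<in> multi_indices n m"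
  then have "a ^ m = (\<Prod>i<n. a ^ \<alpha> i)" by (simp add: multi_indices_def flip: power_sum)
  then show "c \<alpha> * (\<Prod>i<n. (a * z i) ^ \<alpha> i) = a ^ m * (c \<alpha> * (\<Prod>i<n. z i ^ \<alpha> i))"
    by (simp add: power_mult_distrib prod.distrib)
qed

text \<open>For \<open>cmod l = 1 / m\<close> the point u + l w lies in the polydisc of radius 1 + 1
  / m, where the form is at most (1 + 1 / m)^m B \<le> e B; Cauchy's estimate at radius 1 / m then
  costs m^j.\<close>

lemma taylor_part_bound:
  assumes B: "\<And>z. (\<And>i. i < n \<Longrightarrow> cmod (z i) \<le> 1) \<Longrightarrow> cmod (ceval n m c z) \<le> B"
    and m: "m \<ge> 1" and j: "j \<le> m"
    and u: "\<And>i. i < n \<Longrightarrow> cmod (u i) \<le> 1" and w: "\<And>i. i < n \<Longrightarrow> cmod (w i) \<le> 1"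
  shows "cmod (ceval n j (\<lambda>\<gamma>. ceval n (m - j) (taylor_coeff n c \<gamma>) u) w) \<le> exp 1 * real m ^ j * B"
proof -
  define a where "a = 1 + 1 / real m"
  have a: "a > 0" using m by (simp add: a_def add_pos_nonneg)
  have "B \<ge> 0" using order_trans[OF norm_ge_zero B[of "\<lambda>_. 0"]] by simp
  have "a ^ m \<le> exp (1 / real m) ^ m"
    unfolding a_def by (intro power_mono exp_ge_add_one_self) auto
  also have "\<dots> = exp 1" using m by (simp flip: exp_of_nat_mult)
  finally have e: "a ^ m \<le> exp 1" .
  have "cmod (ceval n j (\<lambda>\<gamma>. ceval n (m - j) (taylor_coeff n c \<gamma>) u) w) * (1 / real m) ^ j \<le> exp 1 * B"
  proof (rule cauchy_estimate[where m = m and t = "\<lambda>j. ceval n j (\<lambda>\<gamma>. ceval n (m - j) (taylor_coeff n c \<gamma>) u) w"])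
    fix l assume l: "cmod l = 1 / real m"
    have "cmod (u i + l * w i) \<le> a" if "i < n" for i
    proof -
      have "cmod (u i + l * w i) \<le> cmod (u i) + cmod l * cmod (w i)"
        by (metis norm_mult norm_triangle_ineq)
      also have "\<dots> \<le> 1 + cmod l * 1" using u w that by (intro add_mono mult_left_mono) auto
      finally show ?thesis by (simp add: l a_def)
    qed
    then have "cmod (ceval n m c (\<lambda>i. (u i + l * w i) / of_real a)) \<le> B"
      using a by (intro B) (auto simp: norm_divide)
    then have "a ^ m * cmod (ceval n m c (\<lambda>i. (u i + l * w i) / of_real a)) \<le> exp 1 * B"
      using e a \<open>B \<ge> 0\<close> by (intro mult_mono) auto
    moreover have "ceval n m c (\<lambda>i. u i + l * w i) = of_real a ^ m * ceval n m c (\<lambda>i. (u i + l * w i) / of_real a)"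
      using a by (simp flip: ceval_scale)
    ultimately show "cmod (\<Sum>k\<le>m. l ^ k * ceval n k (\<lambda>\<gamma>. ceval n (m - k) (taylor_coeff n c \<gamma>) u) w) \<le> exp 1 * B"
      using a by (simp add: norm_mult norm_power flip: ceval_taylor)
  qed (use m j in auto)
  then show ?thesis using m by (simp add: field_simps)
qed

text \<open>For each \<gamma> the inner l2 norm is compared with an average over grid points u.
  After exchanging the sums, the degree j inequality is applied at each fixed u to the degree j part
  in w, bounded by \<open>taylor_part_bound\<close>.\<close>

lemma block_mixed_norm:
  assumes BH: "complex_BH j K" and K: "K \<ge> 0" and j: "1 \<le> j" "j \<le> m"
    and B: "\<And>z. (\<And>i. i < n \<Longrightarrow> cmod (z i) \<le> 1) \<Longrightarrow> cmod (ceval n m c z) \<le> B"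
  shows "(\<Sum>\<gamma>\<in>multi_indices n j. (\<Sum>\<beta>\<in>multi_indices n (m - j). (cmod (c (\<lambda>v. \<beta> v + \<gamma> v)))\<^sup>2) powr (rho j / 2))
    \<le> (2 powr (real m / real j) * (K * (exp 1 * real m ^ j * B))) powr rho j"
proof -
  define s where "s = rho j"
  define d where "d = m - j"
  define N where "N = 2 * d + 1"
  define W where "W = real (N ^ n)"
  define Q where "Q = (4 ^ d) powr ((2 - s) / 2)"
  define R where "R = (K * (exp 1 * real m ^ j * B)) powr s"
  define G where "G \<gamma> = (\<Sum>\<beta>\<in>multi_indices n d. (cmod (c (\<lambda>v. \<beta> v + \<gamma> v)))\<^sup>2) powr (s / 2)" for \<gamma>
  define H where "H \<gamma> \<theta> = cmod (ceval n d (taylor_coeff n c \<gamma>) (root_point N \<theta>)) powr s" for \<gamma> \<theta>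
  have s: "0 < s" "s < 2" using rho_bounds[of j] j by (auto simp: s_def)
  have W: "W > 0" by (simp add: W_def N_def)
  have B0: "B \<ge> 0" using order_trans[OF norm_ge_zero B[of "\<lambda>_. 0"]] by simp
  have "W * (\<Sum>\<gamma>\<in>multi_indices n j. G \<gamma>) \<le> (\<Sum>\<gamma>\<in>multi_indices n j. Q * (\<Sum>\<theta>\<in>grid n N. H \<gamma> \<theta>))"
    unfolding sum_distrib_left[of W]
  proof (intro sum_mono)
    fix \<gamma>
    have "W * G \<gamma> \<le> W * (\<Sum>\<beta>\<in>multi_indices n d. (cmod (taylor_coeff n c \<gamma> \<beta>))\<^sup>2) powr (s / 2)"
      unfolding G_def using s W
      by (intro mult_left_mono powr_mono2 sum_mono power_mono norm_taylor_coeff) (auto intro: sum_nonneg)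
    also have "\<dots> \<le> Q * (\<Sum>\<theta>\<in>grid n N. H \<gamma> \<theta>)"
      unfolding Q_def W_def H_def using s by (intro ceval_hypercontractive) (auto simp: N_def)
    finally show "W * G \<gamma> \<le> Q * (\<Sum>\<theta>\<in>grid n N. H \<gamma> \<theta>)" .
  qed
  also have "\<dots> = Q * (\<Sum>\<theta>\<in>grid n N. \<Sum>\<gamma>\<in>multi_indices n j. H \<gamma> \<theta>)"
    by (subst sum.swap) (simp add: sum_distrib_left)
  also have "\<dots> \<le> Q * (\<Sum>\<theta>\<in>grid n N. R)"
  proof (intro mult_left_mono sum_mono)
    fix \<theta>
    have "\<forall>z. (\<forall>i<n. cmod (z i) \<le> 1) \<longrightarrow>
        cmod (ceval n j (\<lambda>\<gamma>. ceval n (m - j) (taylor_coeff n c \<gamma>) (root_point N \<theta>)) z) \<le> exp 1 * real m ^ j * B"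
      using j by (intro allI impI taylor_part_bound[OF B]) auto
    then show "(\<Sum>\<gamma>\<in>multi_indices n j. H \<gamma> \<theta>) \<le> R"
      using BH unfolding complex_BH_def H_def R_def s_def d_def by blast
  qed (simp add: Q_def)
  also have "\<dots> = W * (Q * R)" by (simp add: W_def)
  finally have "(\<Sum>\<gamma>\<in>multi_indices n j. G \<gamma>) \<le> Q * R" using W by simp
  also have "Q * R \<le> (2 powr (real m / real j)) powr s * R"
  proof (rule mult_right_mono)
    have "2 powr real (2 * d) = (2::real) ^ (2 * d)" by (rule powr_realpow) simp
    then have "(4::real) ^ d = 2 powr (2 * real d)" by (simp add: power_mult)
    then have "Q = 2 powr (real d * (2 - s))" by (simp add: Q_def powr_powr)
    \<comment> \<open>Here 2 - rho j = rho j / j, so the loss becomes 2^(d / j) after taking the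
      root of order \<open>rho j\<close>.\<close>
    also have "real d * (2 - s) = real d / real j * s"
      using j by (simp add: s_def rho_def field_simps)
    also have "2 powr (real d / real j * s) \<le> 2 powr (real m / real j * s)"
      using s by (intro powr_mono mult_right_mono divide_right_mono) (auto simp: d_def)
    finally show "Q \<le> (2 powr (real m / real j)) powr s" by (simp add: powr_powr)
  qed (simp add: R_def)
  finally show ?thesis
    using K B0 by (simp add: G_def R_def s_def d_def powr_mult)
qed

section \<open>Monomials as sorted words\<close>

definition letter_count :: "nat list \<Rightarrow> nat \<Rightarrow> nat" where
  "letter_count xs = (\<lambda>i. count_list xs i)"

text \<open>A monomial has exactly one nondecreasing spelling: a sorted list is determined by its
  multiset, and sorting the multiset with multiplicities \<alpha> provides one.\<close>

lemma bij_betw_sorted_words: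
  "bij_betw letter_count {xs \<in> words n k. sorted xs} (multi_indices n k)"
  unfolding bij_betw_def
proof
  show "inj_on letter_count {xs \<in> words n k. sorted xs}"
  proof (rule inj_onI)
    fix xs ys assume "xs \<in> {xs \<in> words n k. sorted xs}" "ys \<in> {xs \<in> words n k. sorted xs}"
      and "letter_count xs = letter_count ys"
    then have "mset xs = mset ys" "sorted xs" "sorted ys"
      by (auto simp: multiset_eq_iff count_mset letter_count_def fun_eq_iff)
    then show "xs = ys" by (metis properties_for_sort)
  qed
  show "letter_count ` {xs \<in> words n k. sorted xs} = multi_indices n k"
  proof (intro equalityI subsetI)
    fix \<alpha> assume "\<alpha> \<in> letter_count ` {xs \<in> words n k. sorted xs}"
    then show "\<alpha> \<in> multi_indices n k"
      by (auto simp: multi_indices_def words_def letter_count_def sum_count_set count_list_0_iff)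
  next
    fix \<alpha> assume \<alpha>: "\<alpha> \<in> multi_indices n k"
    then have sub: "{x. 0 < \<alpha> x} \<subseteq> {..<n}" by (auto simp: multi_indices_def) (metis not_less less_irrefl)
    then have fin: "finite {x. 0 < \<alpha> x}" by (rule finite_subset) simp
    define xs where "xs = sorted_list_of_multiset (Abs_multiset \<alpha>)"
    have c: "letter_count xs = \<alpha>"
      using fin by (simp add: letter_count_def xs_def flip: count_mset)
    have "set xs \<subseteq> {..<n}"
      using sub fin by (auto simp: xs_def set_mset_def)
    moreover from this have "length xs = k"
      using \<alpha> c sum_count_set[of xs "{..<n}"] by (simp add: multi_indices_def letter_count_def fun_eq_iff)
    ultimately have "xs \<in> {xs \<in> words n k. sorted xs}" by (simp add: words_def xs_def)
    then show "\<alpha> \<in> letter_count ` {xs \<in> words n k. sorted xs}" using c by blast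
  qed
qed

lemma sum_sorted_words:
  "(\<Sum>xs\<in>words n k. if sorted xs then F (letter_count xs) else 0) = (\<Sum>\<alpha>\<in>multi_indices n k. F \<alpha>)"
  using sum.reindex_bij_betw[OF bij_betw_sorted_words, of F n k]
  by (simp add: sum.inter_filter[symmetric])

text \<open>\<open>blei_words\<close> asks for one \<open>A\<close> serving all block lengths: k
  \<le> j < 2 k bounds m / j by m / k and m^j by m^(2 k).\<close>

lemma complex_BH_step:
  assumes k: "k \<ge> 1" "m \<ge> k" and K: "K \<ge> 0"
    and BH: "\<And>j. k \<le> j \<Longrightarrow> j < 2 * k \<Longrightarrow> complex_BH j K"
  shows "complex_BH m (2 powr (real m / real k) * (K * (exp 1 * real m ^ (2 * k))))"
  unfolding complex_BH_def
proof (intro allI impI)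
  fix n c B assume B: "\<forall>z. (\<forall>i<n. cmod (z i) \<le> 1) \<longrightarrow> cmod (ceval n m c z) \<le> B"
  have B0: "B \<ge> 0" using order_trans[OF norm_ge_zero B[rule_format, of "\<lambda>_. 0"]] by simp
  define A where "A = 2 powr (real m / real k) * (K * (exp 1 * real m ^ (2 * k))) * B"
  have A0: "A \<ge> 0" using K B0 by (simp add: A_def)
  \<comment> \<open>Supporting the coefficient array on sorted words avoids all multiplicities of the symmetrised form.\<close>
  define f where "f xs = (if sorted xs then cmod (c (letter_count xs)) else 0)" for xs
  have "(\<Sum>xs\<in>words n m. f xs powr rho m) \<le> A powr rho m"
  proof (rule blei_words[OF k A0])
    fix p j q assume j: "k \<le> j" "j < 2 * k" and pq: "p + j + q = m"
    define S where "S \<gamma> = (\<Sum>\<beta>\<in>multi_indices n (m - j). (cmod (c (\<lambda>v. \<beta> v + \<gamma> v)))\<^sup>2)" for \<gamma>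
    have rj: "rho j > 0" using j k by (intro rho_bounds) simp
    \<comment> \<open>Deleting the block \<open>x\<close> from a sorted word leaves the sorted word
      \<open>u @ v\<close>. Forgetting whether \<open>x\<close> fits between \<open>u\<close> and
      \<open>v\<close> only enlarges the sum, which then meets each multi-index of degree m - j
      once.\<close>
    have "(\<Sum>u\<in>words n p. \<Sum>v\<in>words n q. (f (u @ x @ v))\<^sup>2) \<le> (if sorted x then S (letter_count x) else 0)" for x
    proof -
      define F where "F \<beta> = (cmod (c (\<lambda>i. \<beta> i + letter_count x i)))\<^sup>2" for \<beta>
      have "(\<Sum>u\<in>words n p. \<Sum>v\<in>words n q. (f (u @ x @ v))\<^sup>2)
          \<le> (\<Sum>u\<in>words n p. \<Sum>v\<in>words n q. if sorted x then if sorted (u @ v) then F (letter_count (u @ v)) else 0 else 0)"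
      proof (intro sum_mono)
        fix u v
        have "letter_count (u @ x @ v) = (\<lambda>i. letter_count (u @ v) i + letter_count x i)"
          by (auto simp: letter_count_def)
        then show "(f (u @ x @ v))\<^sup>2 \<le> (if sorted x then if sorted (u @ v) then F (letter_count (u @ v)) else 0 else 0)"
          by (auto simp: f_def F_def sorted_append)
      qed
      also have "\<dots> = (if sorted x then (\<Sum>ys\<in>words n (p + q). if sorted ys then F (letter_count ys) else 0) else 0)"
        by (simp add: sum_words_append)
      also have "(\<Sum>ys\<in>words n (p + q). if sorted ys then F (letter_count ys) else 0)
          = (\<Sum>\<beta>\<in>multi_indices n (p + q). F \<beta>)"
        by (rule sum_sorted_words)
      also have "\<dots> = S (letter_count x)"
        unfolding F_def S_def using pq by (intro sum.cong) auto
      finally show ?thesis .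
    qed
    then have "(\<Sum>x\<in>words n j. (\<Sum>u\<in>words n p. \<Sum>v\<in>words n q. (f (u @ x @ v))\<^sup>2) powr (rho j / 2))
        \<le> (\<Sum>x\<in>words n j. (if sorted x then S (letter_count x) else 0) powr (rho j / 2))"
      using rj by (intro sum_mono powr_mono2) (auto intro!: sum_nonneg)
    also have "\<dots> = (\<Sum>x\<in>words n j. if sorted x then S (letter_count x) powr (rho j / 2) else 0)"
      by (intro sum.cong) auto
    also have "\<dots> = (\<Sum>\<gamma>\<in>multi_indices n j. S \<gamma> powr (rho j / 2))"
      by (rule sum_sorted_words)
    also have "\<dots> \<le> (2 powr (real m / real j) * (K * (exp 1 * real m ^ j * B))) powr rho j"
      unfolding S_def using B j k pq K by (intro block_mixed_norm BH) auto
    also have "\<dots> \<le> A powr rho j"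
    proof (intro powr_mono2)
      have "2 powr (real m / real j) * (K * (exp 1 * real m ^ j * B))
        \<le> 2 powr (real m / real k) * (K * (exp 1 * real m ^ (2 * k) * B))"
        using j k K B0 by (intro mult_mono powr_mono divide_left_mono power_increasing) auto
      then show "2 powr (real m / real j) * (K * (exp 1 * real m ^ j * B)) \<le> A"
        by (simp add: A_def mult_ac)
    qed (use rj K B0 in auto)
    finally show "(\<Sum>x\<in>words n j. (\<Sum>u\<in>words n p. \<Sum>v\<in>words n q. (f (u @ x @ v))\<^sup>2) powr (rho j / 2)) \<le> A powr rho j" .
  qed (simp add: f_def)
  moreover have "(\<Sum>xs\<in>words n m. f xs powr rho m)
      = (\<Sum>xs\<in>words n m. if sorted xs then cmod (c (letter_count xs)) powr rho m else 0)"
    by (intro sum.cong) (auto simp: f_def)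
  ultimately show "(\<Sum>\<alpha>\<in>multi_indices n m. cmod (c \<alpha>) powr rho m)
      \<le> (2 powr (real m / real k) * (K * (exp 1 * real m ^ (2 * k))) * B) powr rho m"
    unfolding A_def using sum_sorted_words[of "\<lambda>\<alpha>. cmod (c \<alpha>) powr rho m"] by simp
qed

lemma complex_BH_1: "complex_BH 1 1"
  unfolding complex_BH_def
proof (intro allI impI)
  fix n c B assume B: "\<forall>z. (\<forall>i<n. cmod (z i) \<le> 1) \<longrightarrow> cmod (ceval n 1 c z) \<le> B"
  define e where "e i = (\<lambda>v. if v = i then 1 else 0 :: nat)" for i :: nat
  have bij: "bij_betw e {..<n} (multi_indices n 1)"
  proof (rule bij_betw_imageI)
    show "inj_on e {..<n}" by (rule inj_onI) (metis e_def zero_neq_one)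
    show "e ` {..<n} = multi_indices n 1"
    proof (intro equalityI subsetI)
      fix \<alpha> assume "\<alpha> \<in> e ` {..<n}"
      then show "\<alpha> \<in> multi_indices n 1" by (auto simp: multi_indices_def e_def)
    next
      fix \<alpha> assume \<alpha>: "\<alpha> \<in> multi_indices n 1"
      then have "(\<Sum>i<n. \<alpha> i) = 1" by (simp add: multi_indices_def)
      then have "\<exists>i\<in>{..<n}. \<alpha> i = 1 \<and> (\<forall>j\<in>{..<n}. i \<noteq> j \<longrightarrow> \<alpha> j = 0)"
        by (simp only: sum_eq_1_iff finite_lessThan)
      then obtain i where i: "i < n" "\<alpha> i = 1" "\<forall>j<n. j \<noteq> i \<longrightarrow> \<alpha> j = 0" by auto
      then have "\<alpha> = e i" using \<alpha> by (auto simp: e_def fun_eq_iff multi_indices_def) (metis not_less)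
      then show "\<alpha> \<in> e ` {..<n}" using i by blast
    qed
  qed
  \<comment> \<open>Conjugate phases turn every term into its modulus; a zero coefficient gives the
    coordinate 0, still in the polydisc. As \<open>rho 1 = 1\<close>, the resulting l1 bound is the
    claim.\<close>
  define z where "z i = cnj (sgn (c (e i)))" for i
  have "ceval n 1 c z = (\<Sum>i<n. c (e i) * (\<Prod>v<n. z v ^ e i v))"
    unfolding ceval_def by (rule sum.reindex_bij_betw[OF bij, symmetric])
  also have "\<dots> = (\<Sum>i<n. complex_of_real (cmod (c (e i))))"
  proof (intro sum.cong refl)
    fix i assume "i \<in> {..<n}"
    then have "(\<Prod>v<n. z v ^ e i v) = (\<Prod>v\<in>{i}. z v)"
      by (intro prod.mono_neutral_cong_right) (auto simp: e_def)
    then show "c (e i) * (\<Prod>v<n. z v ^ e i v) = complex_of_real (cmod (c (e i)))"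
      by (simp add: z_def sgn_eq power2_eq_square flip: of_real_norm_square)
  qed
  finally have "cmod (ceval n 1 c z) = (\<Sum>i<n. cmod (c (e i)))"
    by (simp add: sum_nonneg flip: of_real_sum)
  moreover have "cmod (ceval n 1 c z) \<le> B"
    using B by (auto simp: z_def norm_sgn)
  moreover have "(\<Sum>i<n. cmod (c (e i))) = (\<Sum>\<alpha>\<in>multi_indices n 1. cmod (c \<alpha>))"
    by (rule sum.reindex_bij_betw[OF bij])
  moreover have "B \<ge> 0" using order_trans[OF norm_ge_zero B[rule_format, of "\<lambda>_. 0"]] by simp
  ultimately show "(\<Sum>\<alpha>\<in>multi_indices n 1. cmod (c \<alpha>) powr rho 1) \<le> (1 * B) powr rho 1"
    by (simp add: rho_def)
qed

text \<open>For k = 1 only j = 1 lies in the range k \<le> j < 2 k, so linear forms suffice as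
  input.\<close>

lemma complex_BH_exists: "m \<ge> 1 \<Longrightarrow> \<exists>K>0. complex_BH m K"
  using complex_BH_step[of 1 m 1] complex_BH_1
  by (intro exI[of _ "2 powr real m * (exp 1 * (real m)\<^sup>2)"]) (auto simp: le_Suc_eq numeral_2_eq_2 less_Suc_eq)

lemma complex_BH_subexponential:
  assumes k: "k \<ge> 1"
  shows "\<exists>C>0. \<forall>m\<ge>k. complex_BH m (C * real m ^ (2 * k) * 2 powr (real m / real k))"
proof -
  obtain \<kappa> where \<kappa>: "\<And>j. j \<ge> 1 \<Longrightarrow> \<kappa> j > 0 \<and> complex_BH j (\<kappa> j)"
    using complex_BH_exists by metis
  \<comment> \<open>The sum dominates each of these finitely many constants and depends on k
    only.\<close>
  define K where "K = (\<Sum>j\<in>{k..<2 * k}. \<kappa> j)"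
  have "K > 0" unfolding K_def using k \<kappa> by (intro sum_pos) auto
  have BH: "complex_BH j K" if "k \<le> j" "j < 2 * k" for j
  proof (rule complex_BH_mono)
    show "complex_BH j (\<kappa> j)" "0 \<le> \<kappa> j" using \<kappa>[of j] that k by auto
    show "\<kappa> j \<le> K" unfolding K_def using that k \<kappa> by (intro member_le_sum) (auto intro: less_imp_le)
  qed (use that k in auto)
  have "complex_BH m (K * exp 1 * real m ^ (2 * k) * 2 powr (real m / real k))" if "m \<ge> k" for m
    using complex_BH_step[OF k that _ BH] \<open>K > 0\<close> by (simp add: mult_ac)
  then show ?thesis using \<open>K > 0\<close> by (intro exI[of _ "K * exp 1"]) auto
qed

section \<open>The upper bound\<close>

lemma ceval_of_real:
  "ceval n m (\<lambda>\<alpha>. of_real (a \<alpha>)) (\<lambda>i. of_real (x i)) = of_real (hpoly_eval n m a x)"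
  by (simp add: ceval_def hpoly_eval_def)

text \<open>Boundedness is what makes the real-valued \<open>SUP\<close> in
  \<open>hpoly_norm\<close> an upper bound.\<close>

lemma hpoly_norm_bdd: "bdd_above ((\<lambda>x. \<bar>hpoly_eval n m a x\<bar>) ` {x. \<forall>i<n. \<bar>x i\<bar> \<le> 1})"
proof (rule bdd_aboveI2)
  fix x :: "nat \<Rightarrow> real" assume x: "x \<in> {x. \<forall>i<n. \<bar>x i\<bar> \<le> 1}"
  have "\<bar>hpoly_eval n m a x\<bar> \<le> (\<Sum>\<alpha>\<in>multi_indices n m. \<bar>a \<alpha> * (\<Prod>i<n. x i ^ \<alpha> i)\<bar>)"
    unfolding hpoly_eval_def by (rule sum_abs)
  also have "\<dots> \<le> (\<Sum>\<alpha>\<in>multi_indices n m. \<bar>a \<alpha>\<bar>)"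
  proof (intro sum_mono)
    fix \<alpha>
    have "(\<Prod>i<n. \<bar>x i\<bar> ^ \<alpha> i) \<le> 1"
      using x by (intro prod_le_1) (auto intro: power_le_one)
    then show "\<bar>a \<alpha> * (\<Prod>i<n. x i ^ \<alpha> i)\<bar> \<le> \<bar>a \<alpha>\<bar>"
      by (simp add: abs_mult abs_prod power_abs mult_left_le)
  qed
  finally show "\<bar>hpoly_eval n m a x\<bar> \<le> (\<Sum>\<alpha>\<in>multi_indices n m. \<bar>a \<alpha>\<bar>)" .
qed

lemma hpoly_eval_le_norm: "(\<And>i. i < n \<Longrightarrow> \<bar>x i\<bar> \<le> 1) \<Longrightarrow> \<bar>hpoly_eval n m a x\<bar> \<le> hpoly_norm n m a"
  unfolding hpoly_norm_def by (intro cSUP_upper hpoly_norm_bdd) auto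

lemma hpoly_norm_nonneg: "hpoly_norm n m a \<ge> 0"
  using hpoly_eval_le_norm[of n "\<lambda>_. 0" m a] by (simp add: order_trans[OF abs_ge_zero])

lemma multi_indices_0: "multi_indices n 0 = {\<lambda>_. 0}"
proof -
  have "\<alpha> i = 0" if "\<forall>i\<ge>n. \<alpha> i = 0" "\<forall>i\<in>{..<n}. \<alpha> i = 0" for \<alpha> :: "nat \<Rightarrow> nat" and i
    using that by (cases "i < n") auto
  then show ?thesis by (auto simp: multi_indices_def fun_eq_iff)
qed

text \<open>
  For \<open>\<bar>\<mu>\<bar> = 1\<close> one has \<open>2 \<mu> Re (\<mu> z) = \<mu>\<^sup>2 z + cnj z\<close>, and \<open>P z\<close> is the leading coefficient of the
  polynomial \<open>l \<mapsto> P (cnj z + l z)\<close> in \<open>l = \<mu>\<^sup>2\<close>.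
\<close>

lemma ceval_complexification:
  assumes z: "\<And>i. i < n \<Longrightarrow> cmod (z i) \<le> 1"
  shows "cmod (ceval n m (\<lambda>\<alpha>. of_real (a \<alpha>)) z) \<le> 2 ^ m * hpoly_norm n m a"
proof -
  define c where "c = (\<lambda>\<alpha>. complex_of_real (a \<alpha>))"
  define t where "t k = ceval n k (\<lambda>\<gamma>. ceval n (m - k) (taylor_coeff n c \<gamma>) (\<lambda>i. cnj (z i))) z" for k
  \<comment> \<open>For k = m only \<beta> = 0 remains, and all binomial factors are 1.\<close>
  have "t m = ceval n m c z"
    by (simp add: t_def) (simp add: ceval_def multi_indices_0 taylor_coeff_def)
  moreover have "cmod (t m) * 1 ^ m \<le> 2 ^ m * hpoly_norm n m a"
  proof (rule cauchy_estimate[where m = m])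
    fix l :: complex assume "cmod l = 1"
    define \<mu> where "\<mu> = csqrt l"
    have \<mu>: "\<mu>\<^sup>2 = l" "cmod \<mu> = 1" using \<open>cmod l = 1\<close> by (simp_all add: \<mu>_def)
    then have "\<mu> * cnj \<mu> = 1" by (simp flip: of_real_norm_square)
    then have "cnj (z i) + l * z i = 2 * \<mu> * of_real (Re (\<mu> * z i))" for i
    proof -
      have "2 * complex_of_real (Re (\<mu> * z i)) = \<mu> * z i + cnj \<mu> * cnj (z i)"
        by (simp add: complex_add_cnj flip: complex_cnj_mult)
      then have "2 * \<mu> * of_real (Re (\<mu> * z i)) = \<mu> * (\<mu> * z i + cnj \<mu> * cnj (z i))"
        by (metis mult.commute mult.left_commute)
      also have "\<dots> = \<mu>\<^sup>2 * z i + (\<mu> * cnj \<mu>) * cnj (z i)"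
        by (simp only: power2_eq_square distrib_left mult.assoc)
      finally show ?thesis using \<mu> \<open>\<mu> * cnj \<mu> = 1\<close> by simp
    qed
    \<comment> \<open>Homogeneity takes out the common factor 2 \<mu> and leaves a real point of the
      cube.\<close>
    then have "(\<Sum>k\<le>m. l ^ k * t k) = (2 * \<mu>) ^ m * of_real (hpoly_eval n m a (\<lambda>i. Re (\<mu> * z i)))"
      unfolding t_def ceval_taylor[symmetric] c_def by (simp only: ceval_scale ceval_of_real)
    then have "cmod (\<Sum>k\<le>m. l ^ k * t k) = 2 ^ m * \<bar>hpoly_eval n m a (\<lambda>i. Re (\<mu> * z i))\<bar>"
      using \<mu> by (simp add: norm_mult norm_power)
    also have "\<dots> \<le> 2 ^ m * hpoly_norm n m a"
    proof (intro mult_left_mono hpoly_eval_le_norm)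
      fix i assume "i < n"
      have "\<bar>Re (\<mu> * z i)\<bar> \<le> cmod (\<mu> * z i)" by (rule abs_Re_le_cmod)
      also have "\<dots> \<le> 1" using z[OF \<open>i < n\<close>] \<mu> by (simp add: norm_mult)
      finally show "\<bar>Re (\<mu> * z i)\<bar> \<le> 1" .
    qed simp
    finally show "cmod (\<Sum>k\<le>m. l ^ k * t k) \<le> 2 ^ m * hpoly_norm n m a" .
  qed auto
  ultimately show ?thesis by (simp add: c_def)
qed

section \<open>Admissible constants and their infimum\<close>

abbreviation BH_constants :: "nat \<Rightarrow> real set" where
  "BH_constants m \<equiv> {D. D > 0 \<and>
     (\<forall>n\<ge>1. \<forall>a. coeff_norm n m (2 * real m / (real m + 1)) a \<le> D * hpoly_norm n m a)}"

text \<open>The factor 2^m is the price of passing from the real cube to the polydisc in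
  \<open>ceval_complexification\<close>.\<close>

lemma BH_constants_complex:
  assumes m: "m \<ge> 1" and K: "K > 0" and BH: "complex_BH m K"
  shows "2 ^ m * K \<in> BH_constants m"
proof -
  have "coeff_norm n m (rho m) a \<le> 2 ^ m * K * hpoly_norm n m a" for n a
  proof -
    define V where "V = hpoly_norm n m a"
    have V: "V \<ge> 0" by (simp add: V_def hpoly_norm_nonneg)
    have r: "rho m > 0" using m by (rule rho_bounds)
    have "(\<Sum>\<alpha>\<in>multi_indices n m. cmod (of_real (a \<alpha>)) powr rho m) \<le> (K * (2 ^ m * V)) powr rho m"
      using BH ceval_complexification[of n _ m a] unfolding complex_BH_def V_def by blast
    then have "coeff_norm n m (rho m) a \<le> ((K * (2 ^ m * V)) powr rho m) powr (1 / rho m)"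
      unfolding coeff_norm_def using r by (intro powr_mono2) (auto intro: sum_nonneg)
    also have "\<dots> = K * (2 ^ m * V)" using r K V by (simp add: powr_powr)
    finally show ?thesis by (simp add: V_def mult_ac)
  qed
  then show ?thesis using K by (simp add: rho_def)
qed

text \<open>Lower bounds on the real \<open>Inf\<close> rest on this: over an empty set it would
  carry no information.\<close>

lemma BH_constants_nonempty: "m \<ge> 1 \<Longrightarrow> BH_constants m \<noteq> {}"
  using complex_BH_exists[of m] BH_constants_complex[of m] by blast

lemma BH_const_le: "D \<in> BH_constants m \<Longrightarrow> BH_const m \<le> D"
  unfolding BH_const_def by (intro cInf_lower bdd_belowI[of _ 0]) auto

lemma BH_const_ge: "m \<ge> 1 \<Longrightarrow> (\<And>D. D \<in> BH_constants m \<Longrightarrow> L \<le> D) \<Longrightarrow> L \<le> BH_const m"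
  unfolding BH_const_def by (rule cInf_greatest[OF BH_constants_nonempty])

lemma BH_const_nonneg: "m \<ge> 1 \<Longrightarrow> BH_const m \<ge> 0"
  by (rule BH_const_ge) auto

lemma limsup_BH_const_le_approx:
  assumes k: "k \<ge> 1"
  shows "limsup (\<lambda>m. ereal (BH_const m powr (1 / real m))) \<le> ereal (2 * 2 powr (1 / real k))"
proof -
  obtain C where C: "C > 0" "\<And>m. m \<ge> k \<Longrightarrow> complex_BH m (C * real m ^ (2 * k) * 2 powr (real m / real k))"
    using complex_BH_subexponential[OF k] by blast
  \<comment> \<open>The m-th root of the upper bound; the factors from \<open>C\<close> and from the
    power of m tend to 1.\<close>
  define g where "g m = C powr (1 / real m) * (real m powr (1 / real m)) ^ (2 * k) * (2 * 2 powr (1 / real k))" for m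
  have "(\<lambda>m. C powr (1 / real m)) \<longlonglongrightarrow> 1" "(\<lambda>m. real m powr (1 / real m)) \<longlonglongrightarrow> 1"
    using C(1) by real_asymp+
  then have "g \<longlonglongrightarrow> 1 * 1 ^ (2 * k) * (2 * 2 powr (1 / real k))"
    unfolding g_def by (intro tendsto_intros)
  then have lim: "(\<lambda>m. ereal (g m)) \<longlonglongrightarrow> ereal (2 * 2 powr (1 / real k))" by simp
  have "BH_const m powr (1 / real m) \<le> g m" if m: "m \<ge> k" for m
  proof -
    have m0: "real m > 0" using m k by simp
    have "BH_const m \<le> 2 ^ m * (C * real m ^ (2 * k) * 2 powr (real m / real k))"
      using C m m0 by (intro BH_const_le BH_constants_complex) auto
    then have "BH_const m powr (1 / real m)
        \<le> (2 ^ m * (C * real m ^ (2 * k) * 2 powr (real m / real k))) powr (1 / real m)"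
      using m k by (intro powr_mono2 BH_const_nonneg) auto
    also have "\<dots> = (2 ^ m) powr (1 / real m) * (C powr (1 / real m) * (real m ^ (2 * k)) powr (1 / real m)
        * (2 powr (real m / real k)) powr (1 / real m))"
      by (simp only: powr_mult)
    also have "(2 ^ m) powr (1 / real m) = (2::real)" using m0 by (subst power_powr) auto
    also have "(2 powr (real m / real k)) powr (1 / real m) = 2 powr (1 / real k)"
      using m0 by (simp add: powr_powr)
    also have "(real m ^ (2 * k)) powr (1 / real m) = (real m powr (1 / real m)) ^ (2 * k)"
      using m0 k by (subst power_powr) (auto simp: powr_power)
    finally show ?thesis by (simp add: g_def mult_ac)
  qed
  then have "limsup (\<lambda>m. ereal (BH_const m powr (1 / real m))) \<le> limsup (\<lambda>m. ereal (g m))"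
    by (intro Limsup_mono) (auto simp: eventually_sequentially)
  also have "\<dots> = ereal (2 * 2 powr (1 / real k))"
    by (rule lim_imp_Limsup[OF _ lim]) simp
  finally show ?thesis .
qed

lemma limsup_BH_const_le: "limsup (\<lambda>m. ereal (BH_const m powr (1 / real m))) \<le> 2"
proof (rule LIMSEQ_le_const)
  have "(\<lambda>k. 2 * 2 powr (1 / real k)) \<longlonglongrightarrow> 2" by real_asymp
  then show "(\<lambda>k. ereal (2 * 2 powr (1 / real k))) \<longlonglongrightarrow> 2"
    by simp
  show "\<exists>N. \<forall>k\<ge>N. limsup (\<lambda>m. ereal (BH_const m powr (1 / real m))) \<le> ereal (2 * 2 powr (1 / real k))"
    using limsup_BH_const_le_approx by blast
qed

section \<open>The lower bound\<close>

text \<open>Real coefficients are recorded by existence only, so that forms can be combined without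
  naming the coefficients of the result.\<close>

definition is_form :: "nat \<Rightarrow> nat \<Rightarrow> ((nat \<Rightarrow> complex) \<Rightarrow> complex) \<Rightarrow> bool" where
  "is_form n m F \<longleftrightarrow> (\<exists>a. \<forall>z. F z = ceval n m (\<lambda>\<alpha>. complex_of_real (a \<alpha>)) z)"

lemma is_form_one: "is_form n 0 (\<lambda>z. 1)"
  unfolding is_form_def by (intro exI[of _ "\<lambda>_. 1"]) (simp add: ceval_def multi_indices_0)

lemma is_form_var:
  assumes "v < n"
  shows "is_form n 1 (\<lambda>z. z v)"
proof -
  define e where "e = (\<lambda>i. if i = v then 1 else 0 :: nat)"
  have e: "e \<in> multi_indices n 1" using assms by (simp add: multi_indices_def e_def)
  have eq: "z v = ceval n 1 (\<lambda>\<alpha>. complex_of_real (if \<alpha> = e then 1 else 0)) z" for z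
  proof -
    have "ceval n 1 (\<lambda>\<alpha>. complex_of_real (if \<alpha> = e then 1 else 0)) z = (\<Sum>\<alpha>\<in>{e}. \<Prod>i<n. z i ^ \<alpha> i)"
      unfolding ceval_def using e
      by (intro sum.mono_neutral_cong_right finite_multi_indices) auto
    also have "\<dots> = (\<Prod>i<n. z i ^ e i)" by simp
    also have "\<dots> = (\<Prod>i\<in>{v}. z i)"
      using assms by (intro prod.mono_neutral_cong_right) (auto simp: e_def)
    finally show ?thesis by simp
  qed
  show ?thesis unfolding is_form_def by (intro exI allI) (rule eq)
qed

lemma is_form_diff:
  assumes "is_form n m F" "is_form n m G"
  shows "is_form n m (\<lambda>z. F z - G z)"
proof -
  obtain a b where "\<And>z. F z = ceval n m (\<lambda>\<alpha>. complex_of_real (a \<alpha>)) z"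
    "\<And>z. G z = ceval n m (\<lambda>\<alpha>. complex_of_real (b \<alpha>)) z"
    using assms unfolding is_form_def by blast
  then show ?thesis unfolding is_form_def
    by (intro exI[of _ "\<lambda>\<alpha>. a \<alpha> - b \<alpha>"]) (simp add: ceval_def left_diff_distrib sum_subtractf)
qed

lemma is_form_mult:
  assumes "is_form n m F" "is_form n m' G"
  shows "is_form n (m + m') (\<lambda>z. F z * G z)"
proof -
  obtain a b where F: "\<And>z. F z = ceval n m (\<lambda>\<alpha>. complex_of_real (a \<alpha>)) z"
    and G: "\<And>z. G z = ceval n m' (\<lambda>\<alpha>. complex_of_real (b \<alpha>)) z"
    using assms unfolding is_form_def by blast
  define S where "S = multi_indices n m \<times> multi_indices n m'"
  define s :: "(nat \<Rightarrow> nat) \<times> (nat \<Rightarrow> nat) \<Rightarrow> nat \<Rightarrow> nat" where "s = (\<lambda>(\<alpha>, \<beta>) v. \<alpha> v + \<beta> v)"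
  define d where "d \<gamma> = (\<Sum>p\<in>{p\<in>S. s p = \<gamma>}. a (fst p) * b (snd p))" for \<gamma>
  have fin: "finite S" by (simp add: S_def finite_multi_indices)
  have sub: "s ` S \<subseteq> multi_indices n (m + m')"
    by (auto simp: S_def s_def multi_indices_def sum.distrib)
  have "F z * G z = ceval n (m + m') (\<lambda>\<gamma>. complex_of_real (d \<gamma>)) z" for z
  proof -
    define h where "h p = complex_of_real (a (fst p) * b (snd p)) * (\<Prod>i<n. z i ^ s p i)" for p
    have "F z * G z = (\<Sum>p\<in>S. h p)"
      by (simp add: F G ceval_def sum_product sum.cartesian_product S_def h_def s_def split_def
          power_add prod.distrib mult_ac)
    also have "\<dots> = (\<Sum>\<gamma>\<in>multi_indices n (m + m'). \<Sum>p\<in>{p\<in>S. s p = \<gamma>}. h p)"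
      by (rule sum.group[OF fin finite_multi_indices sub, symmetric])
    also have "\<dots> = ceval n (m + m') (\<lambda>\<gamma>. complex_of_real (d \<gamma>)) z"
      unfolding ceval_def d_def of_real_sum sum_distrib_right by (intro sum.cong) (auto simp: h_def)
    finally show ?thesis .
  qed
  then show ?thesis unfolding is_form_def by blast
qed

lemma is_form_power:
  assumes "is_form n m F"
  shows "is_form n (j * m) (\<lambda>z. F z ^ j)"
proof (induction j)
  case (Suc j)
  then show ?case using is_form_mult[OF assms Suc.IH] by simp
qed (simp add: is_form_one)

text \<open>
  A difference of squares of reals from \<open>[-1, 1]\<close> stays in \<open>[-1, 1]\<close>, while over the complex numbers the
  two squares can be made to add up, so that the maximum modulus \<open>M\<close> becomes \<open>2 M\<^sup>2\<close>.
\<close>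

fun iter_diff :: "nat \<Rightarrow> nat \<Rightarrow> (nat \<Rightarrow> complex) \<Rightarrow> complex" where
  "iter_diff 0 v z = z v"
| "iter_diff (Suc k) v z = (iter_diff k v z)\<^sup>2 - (iter_diff k (v + 2 ^ k) z)\<^sup>2"

lemma is_form_iter_diff: "v + 2 ^ k \<le> n \<Longrightarrow> is_form n (2 ^ k) (iter_diff k v)"
proof (induction k arbitrary: v)
  case 0
  have "is_form n 1 (\<lambda>z. z v)" using 0 by (intro is_form_var) simp
  moreover have "iter_diff 0 v = (\<lambda>z. z v)" by (rule ext) simp
  ultimately show ?case by (simp only: power_0)
next
  case (Suc k)
  have "is_form n (2 * 2 ^ k) (\<lambda>z. (iter_diff k v z)\<^sup>2 - (iter_diff k (v + 2 ^ k) z)\<^sup>2)"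
    using Suc.prems by (intro is_form_diff is_form_power Suc.IH) auto
  moreover have "iter_diff (Suc k) v = (\<lambda>z. (iter_diff k v z)\<^sup>2 - (iter_diff k (v + 2 ^ k) z)\<^sup>2)"
    by (rule ext) simp
  ultimately show ?case by simp
qed

text \<open>The two halves depend on disjoint blocks of variables, so their maximisers can be glued
  together.\<close>

lemma iter_diff_cong:
  "(\<And>i. v \<le> i \<Longrightarrow> i < v + 2 ^ k \<Longrightarrow> z i = z' i) \<Longrightarrow> iter_diff k v z = iter_diff k v z'"
proof (induction k arbitrary: v)
  case (Suc k)
  have "iter_diff k v z = iter_diff k v z'" "iter_diff k (v + 2 ^ k) z = iter_diff k (v + 2 ^ k) z'"
    using Suc.prems by (auto intro!: Suc.IH)
  then show ?case by simp
qed auto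

lemma iter_diff_real:
  assumes "\<And>i. v \<le> i \<Longrightarrow> i < v + 2 ^ k \<Longrightarrow> \<bar>x i\<bar> \<le> 1"
  shows "\<exists>r. \<bar>r\<bar> \<le> 1 \<and> iter_diff k v (\<lambda>i. of_real (x i)) = of_real r"
  using assms
proof (induction k arbitrary: v)
  case (Suc k)
  obtain r where r: "\<bar>r\<bar> \<le> 1" "iter_diff k v (\<lambda>i. of_real (x i)) = of_real r"
    using Suc.IH[of v] Suc.prems by auto
  obtain r' where r': "\<bar>r'\<bar> \<le> 1" "iter_diff k (v + 2 ^ k) (\<lambda>i. of_real (x i)) = of_real r'"
    using Suc.IH[of "v + 2 ^ k"] Suc.prems by auto
  have "r\<^sup>2 \<le> 1" "r'\<^sup>2 \<le> 1" using r(1) r'(1) by (auto simp: abs_square_le_1)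
  then have "\<bar>r\<^sup>2 - r'\<^sup>2\<bar> \<le> 1" by (smt (verit) zero_le_power2)
  then show ?case using r r' by (intro exI[of _ "r\<^sup>2 - r'\<^sup>2"]) simp
qed auto

text \<open>The arbitrary phase \<open>u\<close> carries the induction: with the halves at phases
  \<open>csqrt u\<close> and \<open>csqrt (- u)\<close> the difference of squares is 2 M^2 u, and M
  = \<open>2 ^ (2 ^ k - 1)\<close> solves this recursion.\<close>

lemma iter_diff_complex:
  "cmod u = 1 \<Longrightarrow> \<exists>z. (\<forall>i. cmod (z i) \<le> 1) \<and> iter_diff k v z = 2 ^ (2 ^ k - 1) * u"
proof (induction k arbitrary: u v)
  case 0
  then show ?case by (intro exI[of _ "\<lambda>_. u"]) simp
next
  case (Suc k)
  have "cmod (csqrt u) = 1" "cmod (csqrt (- u)) = 1" using Suc.prems by simp_all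
  then obtain z z' where z: "\<forall>i. cmod (z i) \<le> 1" "iter_diff k v z = 2 ^ (2 ^ k - 1) * csqrt u"
    and z': "\<forall>i. cmod (z' i) \<le> 1" "iter_diff k (v + 2 ^ k) z' = 2 ^ (2 ^ k - 1) * csqrt (- u)"
    using Suc.IH by meson
  define y where "y i = (if i < v + 2 ^ k then z i else z' i)" for i
  have "iter_diff k v y = iter_diff k v z" "iter_diff k (v + 2 ^ k) y = iter_diff k (v + 2 ^ k) z'"
    by (auto intro!: iter_diff_cong simp: y_def)
  then have "iter_diff (Suc k) v y = (2 ^ (2 ^ k - 1))\<^sup>2 * u + (2 ^ (2 ^ k - 1))\<^sup>2 * u"
    using z z' by (simp add: power_mult_distrib)
  also have "\<dots> = 2 ^ Suc ((2 ^ k - 1) * 2) * u" by (simp add: power_mult)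
  also have "Suc (((2::nat) ^ k - 1) * 2) = 2 ^ Suc k - 1"
  proof -
    have "(1::nat) \<le> 2 ^ k" by simp
    then show ?thesis unfolding power_Suc by linarith
  qed
  finally have "iter_diff (Suc k) v y = 2 ^ (2 ^ Suc k - 1) * u" .
  moreover have "\<forall>i. cmod (y i) \<le> 1" using z z' by (simp add: y_def)
  ultimately show ?case by blast
qed

text \<open>Crude, but for fixed n polynomial in m, hence harmless after taking m-th roots.\<close>

lemma card_multi_indices_le: "card (multi_indices n m) \<le> (m + 1) ^ n"
proof -
  have "card (multi_indices n m) \<le> card (PiE {..<n} (\<lambda>_. {..m}))"
  proof (rule card_inj_on_le[where f = "\<lambda>\<alpha>. restrict \<alpha> {..<n}"])
    show "inj_on (\<lambda>\<alpha>. restrict \<alpha> {..<n}) (multi_indices n m)"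
    proof (rule inj_onI)
      fix \<alpha> \<beta> assume "\<alpha> \<in> multi_indices n m" "\<beta> \<in> multi_indices n m"
        and eq: "restrict \<alpha> {..<n} = restrict \<beta> {..<n}"
      then show "\<alpha> = \<beta>"
        using fun_cong[OF eq] by (auto intro!: multi_indices_eqI simp: restrict_def) meson
    qed
  qed (auto simp: finite_PiE restrict_PiE_iff multi_indices_le split: if_splits)
  then show ?thesis by (simp add: card_PiE)
qed

text \<open>At most (m + 1)^n coefficients contribute to \<open>F z\<close>, and each is bounded by
  the coefficient norm, hence by every admissible \<open>D\<close>, because \<open>F\<close> is at
  most 1 on the real cube.\<close>

lemma BH_const_ge_form:
  assumes m: "m \<ge> 1" and n: "n \<ge> 1" and F: "is_form n m F"
    and real: "\<And>x. (\<And>i. i < n \<Longrightarrow> \<bar>x i\<bar> \<le> 1) \<Longrightarrow> cmod (F (\<lambda>i. of_real (x i))) \<le> 1"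
    and z: "\<And>i. i < n \<Longrightarrow> cmod (z i) \<le> 1"
  shows "cmod (F z) / real (m + 1) ^ n \<le> BH_const m"
proof (rule BH_const_ge[OF m])
  fix D assume "D \<in> BH_constants m"
  then have D: "D > 0" "\<And>n a. n \<ge> 1 \<Longrightarrow> coeff_norm n m (rho m) a \<le> D * hpoly_norm n m a"
    by (auto simp: rho_def)
  obtain a where a: "\<And>z. F z = ceval n m (\<lambda>\<alpha>. complex_of_real (a \<alpha>)) z"
    using F unfolding is_form_def by blast
  define A where "A = multi_indices n m"
  have r: "rho m > 0" using m by (rule rho_bounds)
  have "\<bar>hpoly_eval n m a x\<bar> \<le> 1" if "\<And>i. i < n \<Longrightarrow> \<bar>x i\<bar> \<le> 1" for x
    using real[OF that] by (simp add: a ceval_of_real)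
  then have "hpoly_norm n m a \<le> 1"
    unfolding hpoly_norm_def by (intro cSUP_least) (auto intro!: exI[of _ "\<lambda>_. 0"])
  then have le: "coeff_norm n m (rho m) a \<le> D"
    using D(2)[OF n, of a] mult_left_le[of "hpoly_norm n m a" D] D(1) by linarith
  have "\<bar>a \<alpha>\<bar> \<le> D" if "\<alpha> \<in> A" for \<alpha>
  proof -
    have "\<bar>a \<alpha>\<bar> = (\<bar>a \<alpha>\<bar> powr rho m) powr (1 / rho m)" using r by (simp add: powr_powr)
    also have "\<dots> \<le> coeff_norm n m (rho m) a"
      unfolding coeff_norm_def using r that
      by (intro powr_mono2 member_le_sum) (auto simp: A_def finite_multi_indices)
    finally show ?thesis using le by simp
  qed
  moreover have "cmod (F z) \<le> (\<Sum>\<alpha>\<in>A. \<bar>a \<alpha>\<bar>)"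
    unfolding a ceval_def A_def
  proof (rule sum_norm_le)
    fix \<alpha>
    have "(\<Prod>i<n. cmod (z i) ^ \<alpha> i) \<le> 1"
      using z by (intro prod_le_1) (auto intro: power_le_one)
    then show "cmod (complex_of_real (a \<alpha>) * (\<Prod>i<n. z i ^ \<alpha> i)) \<le> \<bar>a \<alpha>\<bar>"
      by (simp add: norm_mult norm_power mult_left_le flip: prod_norm)
  qed
  ultimately have "cmod (F z) \<le> (\<Sum>\<alpha>\<in>A. D)" by (meson order_trans sum_mono)
  also have "\<dots> = D * real (card A)" by simp
  also have "\<dots> \<le> D * real ((m + 1) ^ n)"
    using D(1) card_multi_indices_le[of n m] by (intro mult_left_mono of_nat_mono) (auto simp: A_def)
  finally show "cmod (F z) / real (m + 1) ^ n \<le> D" by (simp add: divide_le_eq add_pos_nonneg)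
qed

text \<open>The j-th power raises the degree without adding variables, so for fixed k the
  denominator stays polynomial in j.\<close>

lemma BH_const_ge_iter_diff:
  assumes j: "j \<ge> 1"
  shows "2 ^ ((2 ^ k - 1) * j) / real (j * 2 ^ k + 1) ^ (2 ^ k) \<le> BH_const (j * 2 ^ k)"
proof -
  define F where "F = (\<lambda>z. iter_diff k 0 z ^ j)"
  obtain z where z: "\<forall>i. cmod (z i) \<le> 1" "iter_diff k 0 z = 2 ^ (2 ^ k - 1) * 1"
    using iter_diff_complex[of 1 k 0] by auto
  have "cmod (F z) / real (j * 2 ^ k + 1) ^ (2 ^ k) \<le> BH_const (j * 2 ^ k)"
  proof (rule BH_const_ge_form[where F = F and z = z])
    show "is_form (2 ^ k) (j * 2 ^ k) F"
      unfolding F_def by (intro is_form_power is_form_iter_diff) simp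
    fix x :: "nat \<Rightarrow> real" assume "\<And>i. i < 2 ^ k \<Longrightarrow> \<bar>x i\<bar> \<le> 1"
    then obtain r where "\<bar>r\<bar> \<le> 1" "iter_diff k 0 (\<lambda>i. of_real (x i)) = of_real r"
      using iter_diff_real[of 0 k x] by auto
    then show "cmod (F (\<lambda>i. of_real (x i))) \<le> 1" by (simp add: F_def norm_power power_le_one)
  qed (use j z in auto)
  moreover have "cmod (F z) = 2 ^ ((2 ^ k - 1) * j)"
    by (simp add: F_def z norm_power power_mult)
  ultimately show ?thesis by simp
qed

lemma limsup_BH_const_ge_approx:
  "ereal (2 powr (1 - 1 / 2 ^ k)) \<le> limsup (\<lambda>m. ereal (BH_const m powr (1 / real m)))"
proof -
  define X where "X = (\<lambda>m. ereal (BH_const m powr (1 / real m)))"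
  \<comment> \<open>Degrees of the powers of one fixed form; \<open>Suc j\<close> keeps them
    positive.\<close>
  define q where "q j = Suc j * 2 ^ k" for j :: nat
  \<comment> \<open>The m-th root of the lower bound: the exponent of 2 is the fraction (2^k - 1) /
    2^k of the degree, and the denominator tends to 1.\<close>
  define g where "g m = 2 powr (1 - 1 / 2 ^ k) / ((real m + 1) powr (1 / real m)) ^ (2 ^ k)" for m
  have q: "strict_mono q" by (simp add: q_def strict_mono_Suc_iff)
  have "(\<lambda>m. (real m + 1) powr (1 / real m)) \<longlonglongrightarrow> 1" by real_asymp
  then have "g \<longlonglongrightarrow> 2 powr (1 - 1 / 2 ^ k) / 1 ^ (2 ^ k)"
    unfolding g_def by (intro tendsto_intros) auto
  then have "(\<lambda>m. ereal (g m)) \<longlonglongrightarrow> ereal (2 powr (1 - 1 / 2 ^ k))" by simp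
  then have lim: "((\<lambda>m. ereal (g m)) \<circ> q) \<longlonglongrightarrow> ereal (2 powr (1 - 1 / 2 ^ k))"
    by (rule LIMSEQ_subseq_LIMSEQ[OF _ q])
  have "g (q j) \<le> BH_const (q j) powr (1 / real (q j))" for j
  proof -
    define m where "m = q j"
    have m: "real m > 0" by (simp add: m_def q_def add_pos_nonneg)
    have "2 ^ ((2 ^ k - 1) * Suc j) / real (m + 1) ^ (2 ^ k) \<le> BH_const m"
      unfolding m_def q_def by (rule BH_const_ge_iter_diff) simp
    then have "(2 ^ ((2 ^ k - 1) * Suc j) / real (m + 1) ^ (2 ^ k)) powr (1 / real m) \<le> BH_const m powr (1 / real m)"
      by (intro powr_mono2) auto
    also have "(2 ^ ((2 ^ k - 1) * Suc j) / real (m + 1) ^ (2 ^ k)) powr (1 / real m)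
        = (2 ^ ((2 ^ k - 1) * Suc j)) powr (1 / real m) / (real (m + 1) ^ (2 ^ k)) powr (1 / real m)"
      by (rule powr_divide)
    also have "(real (m + 1) ^ (2 ^ k)) powr (1 / real m) = ((real m + 1) powr (1 / real m)) ^ (2 ^ k)"
      by (subst power_powr) (auto simp: powr_power add.commute)
    also have "(2 ^ ((2 ^ k - 1) * Suc j)) powr (1 / real m) = (2::real) powr (1 - 1 / 2 ^ k)"
    proof -
      have "(2::real) ^ ((2 ^ k - 1) * Suc j) = 2 powr real ((2 ^ k - 1) * Suc j)"
        by (rule powr_realpow[symmetric]) simp
      moreover have "real (2 ^ k - 1) = 2 ^ k - 1" by simp
      then have "real ((2 ^ k - 1) * Suc j) * (1 / real m) = (2 ^ k - 1) * real (Suc j) * (1 / (real (Suc j) * 2 ^ k))"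
        unfolding m_def q_def of_nat_mult by simp
      then have "real ((2 ^ k - 1) * Suc j) * (1 / real m) = (2 ^ k - 1) / 2 ^ k"
        by (simp del: of_nat_Suc)
      ultimately show ?thesis by (simp only: powr_powr) (simp add: diff_divide_distrib)
    qed
    finally show ?thesis by (simp add: g_def m_def)
  qed
  then have "limsup ((\<lambda>m. ereal (g m)) \<circ> q) \<le> limsup (X \<circ> q)"
    by (intro Limsup_mono always_eventually) (auto simp: X_def)
  also have "\<dots> \<le> limsup X" by (rule limsup_subseq_mono[OF q])
  finally show ?thesis
    using lim_imp_Limsup[OF _ lim] by (simp add: X_def)
qed

theorem mainTheorem1:
  "limsup (\<lambda>m. ereal (BH_const m powr (1 / real m))) = 2"
proof (rule antisym[OF limsup_BH_const_le])
  have "(\<lambda>k. 2 powr (1 - 1 / 2 ^ k) :: real) \<longlonglongrightarrow> 2" by real_asymp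
  then have "(\<lambda>k. ereal (2 powr (1 - 1 / 2 ^ k))) \<longlonglongrightarrow> 2"
    by simp
  then show "2 \<le> limsup (\<lambda>m. ereal (BH_const m powr (1 / real m)))"
    by (rule LIMSEQ_le_const2) (use limsup_BH_const_ge_approx in blast)
qed

end
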